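(* Let $\Gamma$ be a tree of loops of genus $g$ such that the longest path of loops in $\Gamma$ consists of at most $g-2$ loops. Then $\Gamma$ is not weakly (geometric) Brill-Noether general.
   Context: A metric graph $\Gamma$ is a compact connected metric space in which every point has a neighborhood isometric to a star-shaped set (equivalently, a finite connected graph with positive edge lengths, viewed as a length space); its genus $g$ is its first Betti number. A loop is a metric graph isometric to a circle of some positive length. A tree of loops is a metric graph that is a union of finitely many loops, any two of which meet in at most one point, such that the intersection graph (one vertex for each loop, an edge when two loops meet) is a tree; its genus is its number of loops. A path of loops in $\Gamma$ is a subgraph formed by the loops corresponding to a path (sequence of distinct, consecutively adjacent vertices) in this tree. A divisor on $\Gamma$ is an element of the free abelian group $\operatorname{Div}(\Gamma)$ on the points of $\Gamma$; its degree is the sum of its coefficients, and it is effective if all coefficients are nonnegative. For a continuous piecewise linear function $f:\Gamma\to\mathbb{R}$ with integer slopes, $\operatorname{div}(f)=\sum_v \operatorname{ord}_v(f)\, v$, where $\operatorname{ord}_v(f)$ is the sum of the incoming slopes of $f$ at $v$; such divisors are called principal. Two divisors are linearly equivalent if their difference is principal. $\operatorname{Pic}^d(\Gamma)$ is the set of linear equivalence classes of divisors of degree $d$. The rank $r(D)$ is $-1$ if $D$ is not equivalent to an effective divisor, and otherwise is the largest nonnegative integer $r$ such that for every effective divisor $E$ of degree $r$ the divisor $D-E$ is equivalent to an effective divisor. For nonnegative integers $r,d$, $W^r_d(\Gamma)\subseteq \operatorname{Pic}^d(\Gamma)$ is the set of classes of divisors of degree $d$ and rank at least $r$. Put $\rho(g,r,d)=g-(r+1)(g-d+r)$.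 A metric graph $\Gamma$ of genus $g$ is weakly (geometric) Brill-Noether general if for all $r,d$ the set $W^r_d(\Gamma)$ is nonempty whenever $\rho(g,r,d)\ge 0$ and empty otherwise. *)

theory Defs
  imports "HOL-Analysis.Analysis" "HOL-Library.Poly_Mapping"
begin

section \<open>Metric graphs\<close>

text \<open>
  A star-shaped set with \<open>n\<close> arms of length \<open>r\<close> is \<open>n\<close> copies of \<open>[0, r)\<close> glued at \<open>0\<close>, with the
  path metric. A chart is an isometry from it onto the open ball of radius \<open>r\<close> around \<open>p\<close> that
  sends the centre to \<open>p\<close>; \<open>\<gamma> i\<close> is its restriction to the \<open>i\<close>-th arm. The case \<open>n = 0\<close> only
  occurs when the metric graph is a single point.
\<close>

definition star_chart ::
    "'a::metric_space set \<Rightarrow> 'a \<Rightarrow> nat \<Rightarrow> real \<Rightarrow> (nat \<Rightarrow> real \<Rightarrow> 'a) \<Rightarrow> bool" where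
  "star_chart \<Gamma> p n r \<gamma> \<longleftrightarrow>
     r > 0 \<and>
     (\<forall>i<n. \<gamma> i 0 = p) \<and>
     (\<forall>i<n. \<forall>j<n. \<forall>s\<in>{0..<r}. \<forall>t\<in>{0..<r}.
        dist (\<gamma> i s) (\<gamma> j t) = (if i = j then \<bar>s - t\<bar> else s + t)) \<and>
     \<Gamma> \<inter> ball p r = insert p (\<Union>i<n. \<gamma> i ` {0..<r})"

text \<open>
  The last conjunct says that the distance is the length of a shortest path (a compact length
  space is geodesic), i.e. that the space is viewed as a length space.
\<close>

definition metric_graph :: "'a::metric_space set \<Rightarrow> bool" where
  "metric_graph \<Gamma> \<longleftrightarrow>
     \<Gamma> \<noteq> {} \<and> compact \<Gamma> \<and> connected \<Gamma> \<and>
     (\<forall>p\<in>\<Gamma>. \<exists>n r \<gamma>. star_chart \<Gamma> p n r \<gamma>) \<and>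
     (\<forall>p\<in>\<Gamma>. \<forall>q\<in>\<Gamma>. \<exists>c. c ` {0..dist p q} \<subseteq> \<Gamma> \<and> c 0 = p \<and> c (dist p q) = q \<and>
        (\<forall>s\<in>{0..dist p q}. \<forall>t\<in>{0..dist p q}. dist (c s) (c t) = \<bar>s - t\<bar>))"

definition valence :: "'a::metric_space set \<Rightarrow> 'a \<Rightarrow> nat" where
  "valence \<Gamma> p = (THE n. \<exists>r \<gamma>. star_chart \<Gamma> p n r \<gamma>)"

text \<open>
  A vertex set of a finite graph model of \<open>\<Gamma>\<close> (loops and multiple edges allowed); the open edges of
  the model are then the connected components of \<open>\<Gamma> - V\<close>.
\<close>

definition vertex_set :: "'a::metric_space set \<Rightarrow> 'a set \<Rightarrow> bool" where
  "vertex_set \<Gamma> V \<longleftrightarrow>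
     finite V \<and> V \<noteq> {} \<and> V \<subseteq> \<Gamma> \<and> {p \<in> \<Gamma>. valence \<Gamma> p \<noteq> 2} \<subseteq> V"

text \<open>
  The first Betti number \<open>|E| - |V| + 1\<close> of any graph model of the connected metric graph \<open>\<Gamma>\<close>; it
  does not depend on the model.
\<close>

definition genus :: "'a::metric_space set \<Rightarrow> int" where
  "genus \<Gamma> =
     (THE g. \<exists>V. vertex_set \<Gamma> V \<and> g = int (card (components (\<Gamma> - V))) - int (card V) + 1)"


section \<open>Trees of loops\<close>

definition is_loop :: "'a::metric_space set \<Rightarrow> bool" where
  "is_loop L \<longleftrightarrow>
     (\<exists>l>0. \<exists>c. L = c ` {0..<l} \<and>
        (\<forall>s\<in>{0..<l}. \<forall>t\<in>{0..<l}. dist (c s) (c t) = min \<bar>s - t\<bar> (l - \<bar>s - t\<bar>)))"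

definition graph_path :: "'v set \<Rightarrow> ('v \<Rightarrow> 'v \<Rightarrow> bool) \<Rightarrow> 'v list \<Rightarrow> bool" where
  "graph_path V adj P \<longleftrightarrow> P \<noteq> [] \<and> set P \<subseteq> V \<and> distinct P \<and> successively adj P"

definition graph_tree :: "'v set \<Rightarrow> ('v \<Rightarrow> 'v \<Rightarrow> bool) \<Rightarrow> bool" where
  "graph_tree V adj \<longleftrightarrow>
     V \<noteq> {} \<and>
     (\<forall>u\<in>V. \<forall>v\<in>V. \<exists>P. graph_path V adj P \<and> hd P = u \<and> last P = v) \<and>
     \<not> (\<exists>P. graph_path V adj P \<and> length P \<ge> 3 \<and> adj (last P) (hd P))"

definition loops_adj :: "'a set \<Rightarrow> 'a set \<Rightarrow> bool" where
  "loops_adj L L' \<longleftrightarrow> L \<noteq> L' \<and> L \<inter> L' \<noteq> {}"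

definition tree_of_loops :: "'a::metric_space set \<Rightarrow> 'a set set \<Rightarrow> bool" where
  "tree_of_loops \<Gamma> \<L> \<longleftrightarrow>
     metric_graph \<Gamma> \<and> finite \<L> \<and> \<Gamma> = \<Union>\<L> \<and> (\<forall>L\<in>\<L>. is_loop L) \<and>
     (\<forall>L\<in>\<L>. \<forall>L'\<in>\<L>. L \<noteq> L' \<longrightarrow> (\<exists>p. L \<inter> L' \<subseteq> {p})) \<and>
     graph_tree \<L> loops_adj"

abbreviation path_of_loops :: "'a set set \<Rightarrow> 'a set list \<Rightarrow> bool" where
  "path_of_loops \<L> P \<equiv> graph_path \<L> loops_adj P"


section \<open>Divisors\<close>

definition Divs :: "'a set \<Rightarrow> ('a \<Rightarrow>\<^sub>0 int) set" where
  "Divs \<Gamma> = {D. Poly_Mapping.keys D \<subseteq> \<Gamma>}"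

definition div_degree :: "('a \<Rightarrow>\<^sub>0 int) \<Rightarrow> int" where
  "div_degree D = (\<Sum>p\<in>Poly_Mapping.keys D. Poly_Mapping.lookup D p)"

definition effective :: "('a \<Rightarrow>\<^sub>0 int) \<Rightarrow> bool" where
  "effective D \<longleftrightarrow> (\<forall>p. Poly_Mapping.lookup D p \<ge> 0)"

text \<open>Near \<open>p\<close>, \<open>f\<close> is linear on each of the \<open>n\<close> arms, with integer outgoing slopes \<open>m i\<close>.\<close>

definition linear_at ::
    "'a::metric_space set \<Rightarrow> ('a \<Rightarrow> real) \<Rightarrow> 'a \<Rightarrow> nat \<Rightarrow> (nat \<Rightarrow> int) \<Rightarrow> bool" where
  "linear_at \<Gamma> f p n m \<longleftrightarrow>
     (\<exists>r \<gamma>. star_chart \<Gamma> p n r \<gamma> \<and>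
        (\<forall>i<n. \<forall>t\<in>{0..<r}. f (\<gamma> i t) = f p + of_int (m i) * t))"

text \<open>
  By compactness, being linear on the arms around every point amounts to having finitely many
  linear pieces.
\<close>

definition PL :: "'a::metric_space set \<Rightarrow> ('a \<Rightarrow> real) \<Rightarrow> bool" where
  "PL \<Gamma> f \<longleftrightarrow> continuous_on \<Gamma> f \<and> (\<forall>p\<in>\<Gamma>. \<exists>n m. linear_at \<Gamma> f p n m)"

text \<open>The sum of the incoming slopes; the incoming slopes are the negatives of the outgoing ones.\<close>

definition ord_at :: "'a::metric_space set \<Rightarrow> ('a \<Rightarrow> real) \<Rightarrow> 'a \<Rightarrow> int" where
  "ord_at \<Gamma> f p = (THE k. \<exists>n m. linear_at \<Gamma> f p n m \<and> k = (\<Sum>i<n. - m i))"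

definition principal :: "'a::metric_space set \<Rightarrow> ('a \<Rightarrow>\<^sub>0 int) \<Rightarrow> bool" where
  "principal \<Gamma> D \<longleftrightarrow>
     D \<in> Divs \<Gamma> \<and> (\<exists>f. PL \<Gamma> f \<and> (\<forall>p\<in>\<Gamma>. Poly_Mapping.lookup D p = ord_at \<Gamma> f p))"

definition lin_equiv :: "'a::metric_space set \<Rightarrow> (('a \<Rightarrow>\<^sub>0 int) \<times> ('a \<Rightarrow>\<^sub>0 int)) set" where
  "lin_equiv \<Gamma> = {(D, E). D \<in> Divs \<Gamma> \<and> E \<in> Divs \<Gamma> \<and> principal \<Gamma> (D - E)}"

definition Pic :: "int \<Rightarrow> 'a::metric_space set \<Rightarrow> ('a \<Rightarrow>\<^sub>0 int) set set" where
  "Pic d \<Gamma> = {D \<in> Divs \<Gamma>. div_degree D = d} // lin_equiv \<Gamma>"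

definition equiv_effective :: "'a::metric_space set \<Rightarrow> ('a \<Rightarrow>\<^sub>0 int) \<Rightarrow> bool" where
  "equiv_effective \<Gamma> D \<longleftrightarrow> (\<exists>E. (D, E) \<in> lin_equiv \<Gamma> \<and> effective E)"

definition div_rank :: "'a::metric_space set \<Rightarrow> ('a \<Rightarrow>\<^sub>0 int) \<Rightarrow> int" where
  "div_rank \<Gamma> D =
     (if \<not> equiv_effective \<Gamma> D then -1
      else int (GREATEST r. \<forall>E\<in>Divs \<Gamma>. effective E \<and> div_degree E = int r \<longrightarrow>
                                        equiv_effective \<Gamma> (D - E)))"


section \<open>Brill-Noether generality\<close>

definition W :: "nat \<Rightarrow> nat \<Rightarrow> 'a::metric_space set \<Rightarrow> ('a \<Rightarrow>\<^sub>0 int) set set" where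
  "W r d \<Gamma> = {X \<in> Pic (int d) \<Gamma>. \<exists>D\<in>X. div_rank \<Gamma> D \<ge> int r}"

definition rho :: "int \<Rightarrow> nat \<Rightarrow> nat \<Rightarrow> int" where
  "rho g r d = g - (int r + 1) * (g - int d + int r)"

definition weakly_BN_general :: "'a::metric_space set \<Rightarrow> bool" where
  "weakly_BN_general \<Gamma> \<longleftrightarrow>
     (\<forall>r d. if rho (genus \<Gamma>) r d \<ge> 0 then W r d \<Gamma> \<noteq> {} else W r d \<Gamma> = {})"

end

theory Submission
  imports Defs
begin

text \<open>
  Let \<open>m\<close> be the number of loops in a longest path, so \<open>m \<le> g - 2\<close>, and let \<open>k = \<lceil>m / 2\<rceil>\<close>. Take \<open>k + 1\<close>
  chips at a centre \<open>v\<close> of the tree. On a circle, two chips at \<open>v\<close> and \<open>y\<close> can be moved to a prescribed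
  point \<open>w\<close> and some other point \<open>x\<close>, and this equivalence extends to \<open>\<Gamma>\<close> by a function that is constant
  on every branch leaving the loop. Hence all but one of several chips at a point of a loop can be moved
  to any other point of that loop, so crossing a loop costs one chip. As every loop is reached from \<open>v\<close>
  through at most \<open>k\<close> loops, a chip can be brought to any point: the divisor has rank at least \<open>1\<close>
  and degree \<open>k + 1\<close>, although \<open>\<rho>(g, 1, k + 1) = 2 k - g \<le> m + 1 - g < 0\<close>. The genus itself never
  has to be computed.
\<close>

subsection \<open>Piecewise linear functions on the line\<close>

text \<open>The definitions measure functions through arbitrary star charts, whereas chips are moved
  in coordinates on a circle. The bridge is the pullback of a function along a periodic
  parametrization of each loop: at a point \<open>p\<close> the arms of any chart match the pairs of
  a loop through \<open>p\<close> and one of its two directions, so \<open>ord_at\<close> becomes a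
  sum over loops of slopes of functions on the real line. The move on a circle is an instance of
  Abel's theorem: two pairs of points are equivalent if their coordinates have the same sum, and a
  tropical quotient of theta functions witnesses this. The function extends to \<Gamma> because the
  intersection graph is a tree, so each branch left after removing a loop touches that loop in a
  single point. Although only a lower bound on the rank is wanted, \<open>div_rank\<close> is a
  \<open>GREATEST\<close> and has a meaning only below some bound; hence principal divisors must be
  shown to have degree zero. The radius k comes from maximality: a side branch that leaves a longest
  path cannot be longer than the part of that path beyond the junction.\<close>

definition slopes_at :: "(real \<Rightarrow> real) \<Rightarrow> real \<Rightarrow> int \<Rightarrow> int \<Rightarrow> bool" where
  "slopes_at F t a b \<longleftrightarrow>
     (\<forall>\<^sub>F s in at_right 0. F (t + s) = F t + of_int a * s \<and> F (t - s) = F t + of_int b * s)"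

text \<open>Both slopes in \<open>slopes_at\<close> point away from \<open>t\<close>, so a straight
  line has \<open>b = - a\<close>, and a convex kink has a positive bend. The sign is opposite to
  that of \<open>ord_at\<close>, which adds incoming slopes.\<close>

definition bend :: "(real \<Rightarrow> real) \<Rightarrow> real \<Rightarrow> int" where
  "bend F t = (THE k. \<exists>a b. slopes_at F t a b \<and> k = a + b)"

lemma slopes_atI:
  assumes "d > 0"
    and "\<And>s. 0 < s \<Longrightarrow> s < d \<Longrightarrow> F (t + s) = F t + of_int a * s"
    and "\<And>s. 0 < s \<Longrightarrow> s < d \<Longrightarrow> F (t - s) = F t + of_int b * s"
  shows "slopes_at F t a b"
  unfolding slopes_at_def eventually_at_right_field using assms by (auto intro!: exI[of _ d])

lemma slopes_at_unique:
  assumes "slopes_at F t a b" "slopes_at F t a' b'"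
  shows "a = a'" "b = b'"
proof -
  have "\<forall>\<^sub>F s::real in at_right 0. s > 0"
    by (simp add: eventually_at_right_less)
  with assms have "\<forall>\<^sub>F s in at_right 0. s > 0 \<and>
      F t + of_int a * s = F t + of_int a' * s \<and> F t + of_int b * s = F t + of_int b' * s"
    unfolding slopes_at_def by eventually_elim auto
  then obtain s :: real where "s > 0" "F t + of_int a * s = F t + of_int a' * s"
      "F t + of_int b * s = F t + of_int b' * s"
    using eventually_happens[of _ "at_right (0::real)"] by auto
  then show "a = a'" "b = b'" by auto
qed

lemma bend_eq: "slopes_at F t a b \<Longrightarrow> bend F t = a + b"
  unfolding bend_def by (rule the_equality) (blast dest: slopes_at_unique)+

lemma slopes_at_const: "slopes_at (\<lambda>_. x) t 0 0"
  by (simp add: slopes_at_def)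

lemma slopes_at_add:
  "slopes_at F t a b \<Longrightarrow> slopes_at G t a' b' \<Longrightarrow> slopes_at (\<lambda>t. F t + G t) t (a + a') (b + b')"
  unfolding slopes_at_def by (erule (1) eventually_elim2) (auto simp: algebra_simps)

lemma slopes_at_uminus:
  "slopes_at F t a b \<Longrightarrow> slopes_at (\<lambda>t. - F t) t (- a) (- b)"
  unfolding slopes_at_def by (erule eventually_mono) (auto simp: algebra_simps)

lemma slopes_at_shift:
  "slopes_at (\<lambda>t. F (t - u)) t a b \<longleftrightarrow> slopes_at F (t - u) a b"
  by (simp add: slopes_at_def algebra_simps)

text \<open>A one-sided linear germ is a line on a short open interval, which therefore contains no
  bend. This isolates the bends.\<close>

lemma slopes_at_right_nbhd:
  assumes "slopes_at F x a b"
  obtains d where "d > 0" "\<And>t. x < t \<Longrightarrow> t < x + d \<Longrightarrow> slopes_at F t a (- a)"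
proof -
  obtain d where d: "d > 0"
    and F: "\<And>s. 0 < s \<Longrightarrow> s < d \<Longrightarrow> F (x + s) = F x + of_int a * s"
    using assms unfolding slopes_at_def eventually_at_right_field by auto
  have F': "F u = F x + of_int a * (u - x)" if "x < u" "u < x + d" for u
    using F[of "u - x"] that by simp
  have "slopes_at F t a (- a)" if "x < t" "t < x + d" for t
    by (rule slopes_atI[of "min (t - x) (x + d - t)"])
      (use that in \<open>auto simp: F' algebra_simps\<close>)
  with d that show ?thesis by blast
qed

lemma slopes_at_reflect: "slopes_at (\<lambda>t. F (- t)) t a b \<longleftrightarrow> slopes_at F (- t) b a"
  by (simp add: slopes_at_def conj_commute)

lemma slopes_at_left_nbhd:
  assumes "slopes_at F x a b"
  obtains d where "d > 0" "\<And>t. x - d < t \<Longrightarrow> t < x \<Longrightarrow> slopes_at F t (- b) b"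
proof -
  have "slopes_at (\<lambda>t. F (- t)) (- x) b a" using assms by (simp add: slopes_at_reflect)
  then obtain d where d: "d > 0"
      "\<And>t. - x < t \<Longrightarrow> t < - x + d \<Longrightarrow> slopes_at (\<lambda>t. F (- t)) t b (- b)"
    using slopes_at_right_nbhd by blast
  have "slopes_at F t (- b) b" if "x - d < t" "t < x" for t
    using d(2)[of "- t"] that by (simp add: slopes_at_reflect)
  with d that show ?thesis by blast
qed

text \<open>Crossing a point changes the right slope by the bend there, so the sum telescopes.
  Bisection gives finiteness and the value together: near each point only that point can bend, and
  half-open intervals make both claims additive.\<close>

lemma sum_bend_interval:
  assumes sl: "\<And>t. slopes_at F t (a t) (b t)" and "u \<le> v"
  shows "finite {t \<in> {u<..v}. bend F t \<noteq> 0} \<and>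
    (\<Sum>t | t \<in> {u<..v} \<and> bend F t \<noteq> 0. bend F t) = a v - a u"
  using \<open>u \<le> v\<close>
proof (induction rule: Bolzano)
  case (trans u v w)
  let ?S = "\<lambda>u v. {t \<in> {u<..v}. bend F t \<noteq> 0}"
  have "?S u w = ?S u v \<union> ?S v w" using trans(3,4) by auto
  moreover have "?S u v \<inter> ?S v w = {}" by auto
  ultimately show ?case using trans(1,2) by (simp add: sum.union_disjoint)
next
  case (local x)
  obtain d1 where d1: "d1 > 0" "\<And>t. x < t \<Longrightarrow> t < x + d1 \<Longrightarrow> slopes_at F t (a x) (- a x)"
    using slopes_at_right_nbhd[OF sl] by blast
  obtain d2 where d2: "d2 > 0" "\<And>t. x - d2 < t \<Longrightarrow> t < x \<Longrightarrow> slopes_at F t (- b x) (b x)"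
    using slopes_at_left_nbhd[OF sl] by blast
  have be: "bend F t = a t + b t" for t by (rule bend_eq[OF sl])
  show ?case
  proof (intro exI[of _ "min d1 d2"] conjI allI impI)
    show "min d1 d2 > 0" using d1 d2 by simp
    fix u v assume uv: "u \<le> x \<and> x \<le> v \<and> v - u < min d1 d2"
    have r: "a t = a x \<and> b t = - a x" if "x < t" "t \<le> v" for t
      using slopes_at_unique[OF sl d1(2)[of t]] that uv by auto
    have l: "a t = - b x \<and> b t = b x" if "u \<le> t" "t < x" for t
      using slopes_at_unique[OF sl d2(2)[of t]] that uv by auto
    have sub: "{t \<in> {u<..v}. bend F t \<noteq> 0} = (if u < x \<and> bend F x \<noteq> 0 then {x} else {})"
    proof (intro equalityI subsetI)
      fix t assume t: "t \<in> {t \<in> {u<..v}. bend F t \<noteq> 0}"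
      then have "\<not> x < t" "\<not> t < x" using r[of t] l[of t] by (auto simp: be)
      with t show "t \<in> (if u < x \<and> bend F x \<noteq> 0 then {x} else {})" by auto
    qed (use uv in \<open>auto split: if_splits\<close>)
    have av: "a v = a x" using r[of v] uv by (cases "x = v") auto
    show "finite {t \<in> {u<..v}. bend F t \<noteq> 0}" unfolding sub by simp
    show "(\<Sum>t | t \<in> {u<..v} \<and> bend F t \<noteq> 0. bend F t) = a v - a u"
      unfolding sub using l[of u] uv by (cases "u = x") (auto simp: av be)
  qed
qed

text \<open>Periodicity makes the right slopes at \<open>0\<close> and \<open>l\<close> equal, so
  the telescoping sum over one period vanishes. This is the circle case of the fact that principal
  divisors have degree zero.\<close>

lemma sum_bend_periodic:
  assumes sl: "\<And>t. \<exists>a b. slopes_at F t a b" and per: "\<And>t. F (t + l) = F t" and "l > 0"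
  shows "finite {t \<in> {0<..l}. bend F t \<noteq> 0}"
    and "(\<Sum>t | t \<in> {0<..l} \<and> bend F t \<noteq> 0. bend F t) = 0"
proof -
  obtain a b where ab: "\<And>t. slopes_at F t (a t) (b t)" using sl by metis
  have "F (t - (- l)) = F t" for t using per by simp
  then have "slopes_at F (0 - (- l)) (a 0) (b 0)"
    using ab[of 0] slopes_at_shift[of F "- l" 0] by simp
  then have "a l = a 0" using slopes_at_unique(1)[OF ab[of l]] by simp
  with sum_bend_interval[of F a b 0 l, OF ab] \<open>l > 0\<close>
  show "finite {t \<in> {0<..l}. bend F t \<noteq> 0}"
    "(\<Sum>t | t \<in> {0<..l} \<and> bend F t \<noteq> 0. bend F t) = 0" by auto
qed

text \<open>
  A tropical theta function: it is convex and piecewise linear, with a bend of \<open>1\<close> exactly at the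
  multiples of \<open>l\<close>.
\<close>

definition theta :: "real \<Rightarrow> real \<Rightarrow> real" where
  "theta l t = of_int \<lfloor>t / l\<rfloor> * t - l * of_int (\<lfloor>t / l\<rfloor> * (\<lfloor>t / l\<rfloor> + 1)) / 2"

text \<open>Quasi-periodicity: the increment over a period is linear in \<open>t\<close>, so it
  cancels in a combination of translates whose coefficients, and whose translations weighted by
  them, sum to zero.\<close>

lemma theta_add_period:
  assumes "l > 0"
  shows "theta l (t + l) = theta l t + t"
proof -
  have "(t + l) / l = t / l + 1" using assms by (simp add: add_divide_distrib)
  then have "\<lfloor>(t + l) / l\<rfloor> = \<lfloor>t / l\<rfloor> + 1" by simp
  then show ?thesis by (simp add: theta_def algebra_simps add_divide_distrib)
qed

text \<open>Both ends are included because the formulas for \<open>k\<close> and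
  \<open>k + 1\<close> agree at the common point; a kink can then be read from either side.\<close>

lemma theta_on_piece:
  assumes "l > 0" "of_int k * l \<le> t" "t \<le> (of_int k + 1) * l"
  shows "theta l t = of_int k * t - l * of_int (k * (k + 1)) / 2"
proof (cases "t = (of_int k + 1) * l")
  case True
  then have "t / l = of_int (k + 1)" using assms(1) by simp
  then have "\<lfloor>t / l\<rfloor> = k + 1" by (metis floor_of_int)
  then show ?thesis unfolding theta_def by (simp add: True algebra_simps add_divide_distrib)
next
  case False
  then have "t < (of_int k + 1) * l" using assms by simp
  then have "of_int k \<le> t / l" "t / l < of_int k + 1"
    using assms by (simp_all add: pos_le_divide_eq pos_divide_less_eq)
  then have "\<lfloor>t / l\<rfloor> = k" by (simp add: floor_eq_iff)
  then show ?thesis by (simp add: theta_def)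
qed

lemma theta_slopes:
  assumes l: "l > 0"
  shows "\<exists>a b. slopes_at (theta l) t a b \<and> a + b = (if \<exists>k::int. t = of_int k * l then 1 else 0)"
proof (cases "\<exists>k::int. t = of_int k * l")
  case True
  then obtain k :: int where k: "t = of_int k * l" by blast
  have t: "of_int k * l \<le> t" "t \<le> (of_int k + 1) * l"
    "of_int (k - 1) * l \<le> t" "t \<le> (of_int (k - 1) + 1) * l"
    using l by (simp_all add: k algebra_simps)
  have "slopes_at (theta l) t k (- (k - 1))"
  proof (rule slopes_atI[OF l])
    fix s assume s: "0 < s" "s < l"
    have r: "of_int k * l \<le> t + s" "t + s \<le> (of_int k + 1) * l"
      "of_int (k - 1) * l \<le> t - s" "t - s \<le> (of_int (k - 1) + 1) * l"
      using s by (simp_all add: k algebra_simps)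
    show "theta l (t + s) = theta l t + of_int k * s"
      unfolding theta_on_piece[OF l t(1,2)] theta_on_piece[OF l r(1,2)]
      by (simp add: distrib_left)
    show "theta l (t - s) = theta l t + of_int (- (k - 1)) * s"
      unfolding theta_on_piece[OF l t(3,4)] theta_on_piece[OF l r(3,4)]
      by (simp add: right_diff_distrib left_diff_distrib)
  qed
  with True show ?thesis by force
next
  case False
  define k where "k = \<lfloor>t / l\<rfloor>"
  have "of_int k \<le> t / l" "t / l < of_int k + 1" unfolding k_def by linarith+
  then have k: "of_int k * l \<le> t" "t < (of_int k + 1) * l"
    using l by (simp_all add: pos_le_divide_eq pos_divide_less_eq)
  with False have k': "of_int k * l < t" by (metis less_eq_real_def)
  have "slopes_at (theta l) t k (- k)"
  proof (rule slopes_atI[of "min (t - of_int k * l) ((of_int k + 1) * l - t)"])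
    show "min (t - of_int k * l) ((of_int k + 1) * l - t) > 0" using k k' by simp
    fix s assume s: "0 < s" "s < min (t - of_int k * l) ((of_int k + 1) * l - t)"
    have r: "of_int k * l \<le> t" "t \<le> (of_int k + 1) * l" "of_int k * l \<le> t + s"
      "t + s \<le> (of_int k + 1) * l" "of_int k * l \<le> t - s" "t - s \<le> (of_int k + 1) * l"
      using s k by linarith+
    show "theta l (t + s) = theta l t + of_int k * s"
      "theta l (t - s) = theta l t + of_int (- k) * s"
      unfolding theta_on_piece[OF l r(1,2)] theta_on_piece[OF l r(3,4)] theta_on_piece[OF l r(5,6)]
      by (simp_all add: distrib_left right_diff_distrib)
  qed
  with False show ?thesis by force
qed


subsection \<open>Loops and star charts\<close>

text \<open>The parametrization lives on the whole real line, as the universal cover of the circle,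
  so that coordinates can be added and translated without wrapping. Distances are prescribed up to
  half the length, beyond which the other way around is shorter.\<close>

definition loop_param :: "(real \<Rightarrow> 'a::metric_space) \<Rightarrow> real \<Rightarrow> 'a set \<Rightarrow> bool" where
  "loop_param c l L \<longleftrightarrow> l > 0 \<and> bij_betw c {0<..l} L \<and>
     (\<forall>s t. c s = c t \<longleftrightarrow> (\<exists>k::int. s - t = of_int k * l)) \<and>
     (\<forall>s t. \<bar>s - t\<bar> \<le> l / 2 \<longrightarrow> dist (c s) (c t) = \<bar>s - t\<bar>)"

lemma small_multiple_zero:
  assumes "l > (0::real)" "\<bar>of_int k * l\<bar> < l"
  shows "k = 0"
proof -
  have "\<bar>of_int k\<bar> * l < 1 * l" using assms by (simp add: abs_mult)
  then have "\<bar>of_int k :: real\<bar> < 1" using assms(1) by simp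
  then show ?thesis by linarith
qed

lemma is_loop_param:
  assumes "is_loop L"
  shows "\<exists>c l. loop_param c l L"
proof -
  obtain l g where l: "l > 0" and L: "L = g ` {0..<l}"
    and d: "\<And>s t. s \<in> {0..<l} \<Longrightarrow> t \<in> {0..<l} \<Longrightarrow> dist (g s) (g t) = min \<bar>s - t\<bar> (l - \<bar>s - t\<bar>)"
    using assms unfolding is_loop_def by blast
  define \<rho> where "\<rho> t = t + of_int (- \<lfloor>t / l\<rfloor>) * l" for t :: real
  have \<rho>: "\<rho> t \<in> {0..<l}" for t
  proof -
    show ?thesis
      using floor_divide_lower[OF l, of t] floor_divide_upper[OF l, of t]
      by (simp add: \<rho>_def distrib_right)
  qed
  have \<rho>k: "\<exists>k::int. \<rho> t = t + of_int k * l" for t unfolding \<rho>_def by blast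
  define c where "c t = g (\<rho> t)" for t
  have dc: "dist (c s) (c t) = \<bar>s - t\<bar>" if st: "\<bar>s - t\<bar> \<le> l / 2" for s t
  proof -
    obtain i j :: int where ij: "\<rho> s = s + of_int i * l" "\<rho> t = t + of_int j * l" using \<rho>k by blast
    define k where "k = i - j"
    have e: "\<rho> s - \<rho> t = s - t + of_int k * l" by (simp add: ij k_def left_diff_distrib)
    have "\<bar>\<rho> s - \<rho> t\<bar> < l" using \<rho>[of s] \<rho>[of t] by auto
    \<comment> \<open>Reduced coordinates differ by less than \<open>l\<close>, and
      \<open>s\<close>, \<open>t\<close> by at most \<open>l / 2\<close>, so the two reductions are
      at most one period apart. In each remaining case the minimum in \<open>d\<close> is \<bar>s -
      t\<bar>.\<close>
    then have "\<bar>of_int k * l\<bar> < 2 * l" using st l unfolding e by linarith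
    then have "\<bar>of_int k\<bar> * l < 2 * l" using l by (simp add: abs_mult)
    then have "\<bar>of_int k :: real\<bar> < 2" using l by simp
    then have "k = -1 \<or> k = 0 \<or> k = 1" by linarith
    then show ?thesis
      using d[OF \<rho> \<rho>, of s t] e st l \<open>\<bar>\<rho> s - \<rho> t\<bar> < l\<close> unfolding c_def by (auto simp: min_def)
  qed
  have eq: "c s = c t \<longleftrightarrow> (\<exists>k::int. s - t = of_int k * l)" for s t
  proof
    assume "c s = c t"
    then have "min \<bar>\<rho> s - \<rho> t\<bar> (l - \<bar>\<rho> s - \<rho> t\<bar>) = 0" using d[OF \<rho> \<rho>, of s t] by (simp add: c_def)
    moreover have "\<bar>\<rho> s - \<rho> t\<bar> < l" using \<rho>[of s] \<rho>[of t] by auto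
    ultimately have "\<rho> s = \<rho> t" by (auto simp: min_def split: if_splits)
    moreover obtain i j :: int where ij: "\<rho> s = s + of_int i * l" "\<rho> t = t + of_int j * l"
      using \<rho>k by blast
    ultimately show "\<exists>k::int. s - t = of_int k * l"
      by (intro exI[of _ "j - i"]) (simp add: left_diff_distrib)
  next
    assume "\<exists>k::int. s - t = of_int k * l"
    then obtain k :: int where k: "s - t = of_int k * l" by blast
    obtain i j :: int where ij: "\<rho> s = s + of_int i * l" "\<rho> t = t + of_int j * l" using \<rho>k by blast
    have "\<rho> s - \<rho> t = (s - t) + (of_int i * l - of_int j * l)" by (simp add: ij)
    then have e: "\<rho> s - \<rho> t = of_int (k + i - j) * l" unfolding k by (simp add: algebra_simps)
    have "\<bar>\<rho> s - \<rho> t\<bar> < l" using \<rho>[of s] \<rho>[of t] by auto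
    then have "k + i - j = 0" using small_multiple_zero[OF l, of "k + i - j"] unfolding e by blast
    then show "c s = c t" using e by (simp add: c_def)
  qed
  have "c ` {0<..l} = L"
  proof
    show "c ` {0<..l} \<subseteq> L" using \<rho> by (auto simp: c_def L)
    show "L \<subseteq> c ` {0<..l}"
    proof
      fix x assume "x \<in> L"
      then obtain t where t: "t \<in> {0..<l}" "x = g t" using L by blast
      then have "\<lfloor>t / l\<rfloor> = 0" using l by (simp add: floor_eq_iff)
      then have xt: "x = c t" using t by (simp add: c_def \<rho>_def)
      show "x \<in> c ` {0<..l}"
      proof (cases "t = 0")
        case True
        then have "x = c l" using xt eq[of t l] by (auto intro!: exI[of _ "-1"])
        then show ?thesis using l by auto
      next
        case False
        then show ?thesis using t xt by (intro image_eqI[of _ _ t]) auto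
      qed
    qed
  qed
  moreover have "inj_on c {0<..l}"
  proof (rule inj_onI)
    fix s t assume st: "s \<in> {0<..l}" "t \<in> {0<..l}" "c s = c t"
    then obtain k :: int where k: "s - t = of_int k * l" using eq by blast
    have "\<bar>s - t\<bar> < l" using st by auto
    then show "s = t" using small_multiple_zero[OF l, of k] k by simp
  qed
  ultimately show ?thesis using l eq dc unfolding loop_param_def bij_betw_def by blast
qed

lemma star_chart_shrink:
  assumes ch: "star_chart \<Gamma> p n r \<gamma>" and r': "0 < r'" "r' \<le> r"
  shows "star_chart \<Gamma> p n r' \<gamma>"
proof -
  from ch have r: "r > 0" and z: "\<And>i. i < n \<Longrightarrow> \<gamma> i 0 = p"
    and d: "\<And>i j s t. i < n \<Longrightarrow> j < n \<Longrightarrow> s \<in> {0..<r} \<Longrightarrow> t \<in> {0..<r} \<Longrightarrow>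
        dist (\<gamma> i s) (\<gamma> j t) = (if i = j then \<bar>s - t\<bar> else s + t)"
    and im: "\<Gamma> \<inter> ball p r = insert p (\<Union>i<n. \<gamma> i ` {0..<r})"
    unfolding star_chart_def by blast+
  have dp: "dist p (\<gamma> i t) = t" if "i < n" "t \<in> {0..<r}" for i t
    using d[of i i 0 t] z[of i] that r by simp
  have "\<Gamma> \<inter> ball p r' = (\<Gamma> \<inter> ball p r) \<inter> ball p r'" using r' by auto
  also have "\<dots> = insert p (\<Union>i<n. \<gamma> i ` {0..<r'})"
    unfolding im using r' dp by force
  finally show ?thesis unfolding star_chart_def using r' z d by auto
qed

lemma star_chart_dist:
  assumes "star_chart \<Gamma> p n r \<gamma>" "i < n" "j < n" "0 \<le> s" "s < r" "0 \<le> t" "t < r"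
  shows "dist (\<gamma> i s) (\<gamma> j t) = (if i = j then \<bar>s - t\<bar> else s + t)"
  using assms unfolding star_chart_def by auto

lemma star_chart_centre_dist:
  assumes "star_chart \<Gamma> p n r \<gamma>" "i < n" "0 \<le> t" "t < r"
  shows "dist (\<gamma> i t) p = t"
  using star_chart_dist[OF assms(1,2,2), of t 0] assms unfolding star_chart_def by auto

lemma star_chart_mem:
  assumes "star_chart \<Gamma> p n r \<gamma>" "i < n" "0 \<le> t" "t < r"
  shows "\<gamma> i t \<in> \<Gamma>"
proof -
  have "\<gamma> i t \<in> (\<Union>i<n. \<gamma> i ` {0..<r})" using assms(2-4) by (intro UN_I[of i] image_eqI[of _ _ t]) simp_all
  then show ?thesis using assms(1) unfolding star_chart_def by blast
qed

lemma star_chart_cover: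
  assumes ch: "star_chart \<Gamma> p n r \<gamma>" and "x \<in> \<Gamma>" "dist x p < r" "x \<noteq> p"
  obtains i where "i < n" "x = \<gamma> i (dist x p)"
proof -
  have "x \<in> \<Gamma> \<inter> ball p r" using assms by (simp add: dist_commute)
  then have "x \<in> (\<Union>i<n. \<gamma> i ` {0..<r})" using ch \<open>x \<noteq> p\<close> unfolding star_chart_def by blast
  then obtain i t where "i < n" "0 \<le> t" "t < r" "x = \<gamma> i t" by auto
  with star_chart_centre_dist[OF ch, of i t] that show thesis by metis
qed

text \<open>Serves to make loops closed: the finitely many loops that miss a point then keep a
  positive distance from it.\<close>

lemma loop_param_compact:
  assumes "loop_param c l L"
  shows "compact L"
proof -
  from assms have l: "l > 0" and L: "c ` {0<..l} = L"
    and eq: "\<And>s t. c s = c t \<longleftrightarrow> (\<exists>k::int. s - t = of_int k * l)"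
    and d: "\<And>s t. \<bar>s - t\<bar> \<le> l / 2 \<Longrightarrow> dist (c s) (c t) = \<bar>s - t\<bar>"
    unfolding loop_param_def bij_betw_def by blast+
  have "isCont c t" for t
  proof (unfold continuous_at_eps_delta, intro allI impI)
    fix e :: real assume "e > 0"
    then show "\<exists>d>0. \<forall>s. dist s t < d \<longrightarrow> dist (c s) (c t) < e"
      using l d by (intro exI[of _ "min e (l / 2)"]) (auto simp: dist_real_def)
  qed
  then have "compact (c ` {0..l})"
    by (intro compact_continuous_image) (auto intro: continuous_at_imp_continuous_on)
  moreover have "c ` {0..l} = L"
  proof -
    have "{0..l} = insert 0 {0<..l}" using l by auto
    moreover have "c 0 = c l" using eq[of 0 l] by (auto intro!: exI[of _ "-1"])
    moreover have "c l \<in> L" using L l by force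
    ultimately show ?thesis using L by auto
  qed
  ultimately show ?thesis by simp
qed

text \<open>A coordinate is fixed on every loop once and for all; orientations and base points of
  different loops are unrelated.\<close>

locale param_tree_of_loops =
  fixes \<Gamma> :: "'a::metric_space set" and \<L> :: "'a set set"
    and c :: "'a set \<Rightarrow> real \<Rightarrow> 'a" and l :: "'a set \<Rightarrow> real"
  assumes tree: "tree_of_loops \<Gamma> \<L>"
    and param: "\<And>L. L \<in> \<L> \<Longrightarrow> loop_param (c L) (l L) L"
begin

lemma finite_loops: "finite \<L>"
  using tree unfolding tree_of_loops_def by (elim conjE)

lemma Union_loops: "\<Gamma> = \<Union>\<L>"
  using tree unfolding tree_of_loops_def by (elim conjE)

lemma graph_tree_loops: "graph_tree \<L> loops_adj"
  using tree unfolding tree_of_loops_def by (elim conjE)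

lemma metric_graph: "metric_graph \<Gamma>"
  using tree unfolding tree_of_loops_def by (elim conjE)

lemma loops_meet:
  assumes "L \<in> \<L>" "L' \<in> \<L>" "L \<noteq> L'" "x \<in> L" "x \<in> L'" "y \<in> L" "y \<in> L'"
  shows "x = y"
proof -
  have "\<exists>p. L \<inter> L' \<subseteq> {p}" using tree assms(1-3) unfolding tree_of_loops_def by metis
  with assms(4-) show ?thesis by blast
qed

lemma star_chart_exists: "p \<in> \<Gamma> \<Longrightarrow> \<exists>n r \<gamma>. star_chart \<Gamma> p n r \<gamma>"
  using metric_graph unfolding metric_graph_def by metis

lemma l_pos: "L \<in> \<L> \<Longrightarrow> l L > 0"
  and bij_c: "L \<in> \<L> \<Longrightarrow> bij_betw (c L) {0<..l L} L"
  and c_eq_iff: "L \<in> \<L> \<Longrightarrow> c L s = c L t \<longleftrightarrow> (\<exists>k::int. s - t = of_int k * l L)"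
  and dist_c: "L \<in> \<L> \<Longrightarrow> \<bar>s - t\<bar> \<le> l L / 2 \<Longrightarrow> dist (c L s) (c L t) = \<bar>s - t\<bar>"
  using param[of L] by (simp_all add: loop_param_def)

lemma c_in:
  assumes "L \<in> \<L>"
  shows "c L t \<in> L"
proof -
  let ?k = "\<lceil>t / l L\<rceil> - 1"
  have u: "t - of_int ?k * l L \<in> {0<..l L}"
    using ceiling_divide_lower[OF l_pos[OF assms], of t] ceiling_divide_upper[OF l_pos[OF assms], of t]
    by (simp add: algebra_simps)
  have "c L t = c L (t - of_int ?k * l L)" by (subst c_eq_iff[OF assms]) (intro exI[of _ ?k], simp)
  then show ?thesis using bij_betwE[OF bij_c[OF assms]] u by metis
qed

text \<open>An arbitrary lift of \<open>p\<close> to the line, meaningful for \<open>p\<close> on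
  \<open>L\<close>. Only \<open>c L (\<tau> L p) = p\<close> is used of it, and
  \<open>slopes_at_period\<close> makes slopes independent of the lift.\<close>

definition \<tau> :: "'a set \<Rightarrow> 'a \<Rightarrow> real" where
  "\<tau> L p = (SOME t. c L t = p)"

lemma c_\<tau>:
  assumes "L \<in> \<L>" "p \<in> L"
  shows "c L (\<tau> L p) = p"
proof -
  have "\<exists>t. c L t = p" using bij_betw_imp_surj_on[OF bij_c[OF assms(1)]] assms(2) by (metis imageE)
  then show ?thesis unfolding \<tau>_def by (rule someI_ex)
qed

lemma c_periodic: "L \<in> \<L> \<Longrightarrow> c L (t + l L) = c L t"
  by (subst c_eq_iff) (auto intro!: exI[of _ 1])

lemma slopes_at_period:
  assumes "L \<in> \<L>" "c L s = c L t"
  shows "slopes_at (f \<circ> c L) s a b \<longleftrightarrow> slopes_at (f \<circ> c L) t a b"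
proof -
  obtain k :: int where k: "s - t = of_int k * l L" using assms c_eq_iff by blast
  have "(f \<circ> c L) (u - (- (of_int k * l L))) = (f \<circ> c L) u" for u
    using c_eq_iff[OF assms(1), of "u + of_int k * l L" u] by auto
  then have "(\<lambda>u. (f \<circ> c L) (u - (- (of_int k * l L)))) = f \<circ> c L" by blast
  moreover have "s = t - (- (of_int k * l L))" using k by simp
  ultimately show ?thesis
    using slopes_at_shift[of "f \<circ> c L" "- (of_int k * l L)" t a b] by metis
qed

definition arms :: "'a \<Rightarrow> ('a set \<times> real) set" where
  "arms p = {L \<in> \<L>. p \<in> L} \<times> {1, - 1}"

definition arm_point :: "'a \<Rightarrow> 'a set \<times> real \<Rightarrow> real \<Rightarrow> 'a" where
  "arm_point p A s = c (fst A) (\<tau> (fst A) p + snd A * s)"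

text \<open>Distances tell the arms of a chart apart: \<bar>s - t\<bar> along one arm,
  \<open>s + t\<close> across the centre. Hence each direction of a loop runs along one arm.
  Different directions take different arms, since two loops meet at most once and the two directions
  of one loop diverge. Every arm is taken, since only loops through \<open>p\<close> come near
  \<open>p\<close>.\<close>

lemma arms_star_chart:
  assumes ch: "star_chart \<Gamma> p n r \<gamma>"
  shows "\<exists>idx \<epsilon>. 0 < \<epsilon> \<and> \<epsilon> \<le> r \<and> bij_betw idx (arms p) {..<n} \<and>
    (\<forall>A\<in>arms p. \<forall>s. 0 < s \<and> s < \<epsilon> \<longrightarrow> arm_point p A s = \<gamma> (idx A) s)"
proof -
  have r: "r > 0" using ch unfolding star_chart_def by blast
  have "closed (\<Union>{L \<in> \<L>. p \<notin> L})"
    using finite_loops loop_param_compact[OF param] compact_imp_closed by (intro closed_Union) auto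
  then have "open (- \<Union>{L \<in> \<L>. p \<notin> L})" by (rule open_Compl)
  moreover have "p \<in> - \<Union>{L \<in> \<L>. p \<notin> L}" by auto
  ultimately obtain e0 where e0: "e0 > 0" "ball p e0 \<subseteq> - \<Union>{L \<in> \<L>. p \<notin> L}"
    by (meson open_contains_ball_eq)
  define m where "m = Min (insert 1 (l ` \<L>))"
  have m: "m > 0" "\<And>L. L \<in> \<L> \<Longrightarrow> m \<le> l L"
    unfolding m_def using finite_loops l_pos by auto
  \<comment> \<open>\<open>e0\<close> keeps away the loops that miss \<open>p\<close>;
    \<open>m / 4\<close> keeps coordinate differences between arm points within half a loop, where
    \<open>dist_c\<close> is exact.\<close>
  define \<epsilon> where "\<epsilon> = min (min r e0) (m / 4)"
  have \<epsilon>: "\<epsilon> > 0" "\<epsilon> \<le> r" "\<epsilon> \<le> e0" "\<epsilon> \<le> m / 4"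
    unfolding \<epsilon>_def using r e0(1) m(1) by simp_all
  have \<epsilon>l: "\<epsilon> \<le> l L / 4" if "L \<in> \<L>" for L
    using \<epsilon>(4) m(2)[OF that] by linarith
  have armsD: "fst A \<in> \<L>" "p \<in> fst A" "snd A = 1 \<or> snd A = - 1" if "A \<in> arms p" for A
    using that unfolding arms_def by auto
  have ad: "dist (arm_point p A s) (arm_point p A t) = \<bar>s - t\<bar>"
    if "A \<in> arms p" "0 \<le> s" "s < \<epsilon>" "0 \<le> t" "t < \<epsilon>" for A s t
  proof -
    have "\<bar>(\<tau> (fst A) p + snd A * s) - (\<tau> (fst A) p + snd A * t)\<bar> = \<bar>s - t\<bar>"
      using armsD(3)[OF that(1)] by auto
    moreover have "\<bar>s - t\<bar> \<le> l (fst A) / 2" using \<epsilon>l[OF armsD(1)[OF that(1)]] that by linarith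
    ultimately show ?thesis
      using dist_c[OF armsD(1)[OF that(1)], of "\<tau> (fst A) p + snd A * s" "\<tau> (fst A) p + snd A * t"]
      by (simp only: arm_point_def)
  qed
  have a0: "arm_point p A 0 = p" if "A \<in> arms p" for A
    using c_\<tau> armsD(1,2)[OF that] by (simp add: arm_point_def)
  have ap: "dist (arm_point p A s) p = s" if "A \<in> arms p" "0 \<le> s" "s < \<epsilon>" for A s
    using ad[of A s 0] a0[OF that(1)] that by simp
  have ain: "arm_point p A s \<in> fst A" if "A \<in> arms p" for A s
    unfolding arm_point_def by (rule c_in[OF armsD(1)[OF that]])
  have ex: "\<exists>i<n. arm_point p A s = \<gamma> i s" if A: "A \<in> arms p" and s: "0 < s" "s < \<epsilon>" for A s
  proof -
    have "arm_point p A s \<in> \<Gamma>" using ain[OF A] armsD[OF A] Union_loops by blast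
    moreover have d: "dist (arm_point p A s) p = s" using ap[OF A] s by simp
    moreover have "arm_point p A s \<noteq> p" using d s by auto
    moreover have "dist (arm_point p A s) p < r" using d s \<epsilon>(2) by simp
    ultimately obtain i where "i < n" "arm_point p A s = \<gamma> i (dist (arm_point p A s) p)"
      using star_chart_cover[OF ch] by blast
    with d show ?thesis by auto
  qed
  \<comment> \<open>The arm is read off at the sample distance \<open>\<epsilon> / 2\<close>; the
    distance to that sample then fixes it for all other \<open>s\<close>.\<close>
  define idx where "idx A = (SOME i. i < n \<and> arm_point p A (\<epsilon> / 2) = \<gamma> i (\<epsilon> / 2))" for A
  have idx: "idx A < n" "arm_point p A (\<epsilon> / 2) = \<gamma> (idx A) (\<epsilon> / 2)" if "A \<in> arms p" for A
    using someI_ex[OF ex[OF that, of "\<epsilon> / 2"]] \<epsilon>(1) unfolding idx_def by simp_all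
  have idx_all: "arm_point p A s = \<gamma> (idx A) s" if A: "A \<in> arms p" and s: "0 < s" "s < \<epsilon>" for A s
  proof -
    obtain i where i: "i < n" "arm_point p A s = \<gamma> i s" using ex[OF A s] by blast
    have "dist (\<gamma> i s) (\<gamma> (idx A) (\<epsilon> / 2)) = \<bar>s - \<epsilon> / 2\<bar>"
      using ad[OF A, of s "\<epsilon> / 2"] s i idx[OF A] by simp
    then have "i = idx A"
      using star_chart_dist[OF ch i(1) idx(1)[OF A], of s "\<epsilon> / 2"] s \<epsilon>(1,2) by (auto split: if_splits)
    with i show ?thesis by simp
  qed
  have "inj_on idx (arms p)"
  proof (rule inj_onI)
    fix A B assume A: "A \<in> arms p" and B: "B \<in> arms p" and eq: "idx A = idx B"
    have pt: "arm_point p A (\<epsilon> / 2) = arm_point p B (\<epsilon> / 2)" using idx(2)[OF A] idx(2)[OF B] eq by simp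
    have "arm_point p A (\<epsilon> / 2) \<noteq> p" using ap[OF A, of "\<epsilon> / 2"] \<epsilon>(1) by auto
    then have f: "fst A = fst B"
      using loops_meet[of "fst A" "fst B" "arm_point p A (\<epsilon> / 2)" p] ain[OF A] ain[OF B]
        armsD[OF A] armsD[OF B] pt by metis
    have "snd A = snd B"
    proof (rule ccontr)
      assume "snd A \<noteq> snd B"
      then have "\<bar>(\<tau> (fst A) p + snd A * (\<epsilon> / 2)) - (\<tau> (fst A) p + snd B * (\<epsilon> / 2))\<bar> = \<epsilon>"
        using armsD(3)[OF A] armsD(3)[OF B] \<epsilon>(1) by auto
      moreover have "\<epsilon> \<le> l (fst A) / 2" using \<epsilon>l[OF armsD(1)[OF A]] \<epsilon>(1) by simp
      ultimately have "dist (arm_point p A (\<epsilon> / 2)) (arm_point p B (\<epsilon> / 2)) = \<epsilon>"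
        using dist_c[OF armsD(1)[OF A], of "\<tau> (fst A) p + snd A * (\<epsilon> / 2)"
            "\<tau> (fst A) p + snd B * (\<epsilon> / 2)"]
        by (simp only: arm_point_def f[symmetric])
      with pt \<epsilon>(1) show False by simp
    qed
    with f show "A = B" by (rule prod_eqI)
  qed
  moreover have "idx ` arms p = {..<n}"
  proof
    show "idx ` arms p \<subseteq> {..<n}" using idx by auto
    show "{..<n} \<subseteq> idx ` arms p"
    proof
      fix i assume "i \<in> {..<n}"
      then have i: "i < n" by simp
      let ?s = "\<epsilon> / 2"
      have s: "0 < ?s" "?s < \<epsilon>" using \<epsilon>(1) by auto
      have "\<gamma> i ?s \<in> \<Gamma>" using star_chart_mem[OF ch i] s \<epsilon>(2) by simp
      then obtain L where L: "L \<in> \<L>" "\<gamma> i ?s \<in> L" using Union_loops by blast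
      have dp: "dist (\<gamma> i ?s) p = ?s" using star_chart_centre_dist[OF ch i] s \<epsilon>(2) by simp
      then have "\<gamma> i ?s \<in> ball p e0" using s \<epsilon>(3) by (simp add: dist_commute)
      then have pL: "p \<in> L" using e0(2) L by blast
      define t where "t = \<tau> L (\<gamma> i ?s) - \<tau> L p"
      \<comment> \<open>Rounding selects the representative of the displacement nearest to zero, so
        that its absolute value is the distance from \<open>p\<close>.\<close>
      define k where "k = round (t / l L)"
      define u where "u = t - of_int k * l L"
      have lL: "l L > 0" by (rule l_pos[OF L(1)])
      have "\<bar>of_int k - t / l L\<bar> \<le> 1 / 2" unfolding k_def by (rule of_int_round_abs_le)
      then have "\<bar>of_int k - t / l L\<bar> * l L \<le> 1 / 2 * l L" using lL by (intro mult_right_mono) auto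
      moreover have "\<bar>of_int k - t / l L\<bar> * l L = \<bar>of_int k * l L - t\<bar>"
        using lL by (simp add: abs_mult_pos left_diff_distrib)
      ultimately have u: "\<bar>u\<bar> \<le> l L / 2" by (simp add: u_def abs_minus_commute)
      have "\<tau> L (\<gamma> i ?s) - (\<tau> L p + u) = of_int k * l L" by (simp add: u_def t_def)
      then have "c L (\<tau> L (\<gamma> i ?s)) = c L (\<tau> L p + u)"
        using c_eq_iff[OF L(1)] by blast
      then have cu: "\<gamma> i ?s = c L (\<tau> L p + u)" using c_\<tau> L by simp
      have "dist (c L (\<tau> L p + u)) (c L (\<tau> L p)) = \<bar>u\<bar>"
        using dist_c[OF L(1), of "\<tau> L p + u" "\<tau> L p"] u by simp
      then have "\<bar>u\<bar> = ?s" using dp cu c_\<tau>[OF L(1) pL] by simp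
      then have "u = 1 * ?s \<or> u = (- 1) * ?s" by linarith
      then obtain \<sigma> where \<sigma>: "\<sigma> = 1 \<or> \<sigma> = - 1" "u = \<sigma> * ?s" by blast
      have A: "(L, \<sigma>) \<in> arms p" unfolding arms_def using L pL \<sigma> by auto
      have "\<gamma> i ?s = \<gamma> (idx (L, \<sigma>)) ?s"
        using idx(2)[OF A] cu \<sigma> by (simp add: arm_point_def)
      then have "i = idx (L, \<sigma>)"
        using star_chart_dist[OF ch i idx(1)[OF A], of ?s ?s] s \<epsilon>(2) by (auto split: if_splits)
      with A show "i \<in> idx ` arms p" by blast
    qed
  qed
  ultimately have "bij_betw idx (arms p) {..<n}" by (simp add: bij_betw_def)
  with \<epsilon>(1,2) idx_all show ?thesis by (intro exI[of _ idx] exI[of _ \<epsilon>] conjI) simp_all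
qed

end


subsection \<open>Divisors of functions, loop by loop\<close>

context param_tree_of_loops
begin

lemma arms_sum: "(\<Sum>A\<in>arms p. h A) = (\<Sum>L | L \<in> \<L> \<and> p \<in> L. h (L, 1) + h (L, - 1))"
  unfolding arms_def
  using sum.cartesian_product[of "\<lambda>L \<sigma>. h (L, \<sigma>)" "{1, - 1 :: real}" "{L \<in> \<L>. p \<in> L}"]
  by simp

lemma linear_at_imp_slopes_at:
  assumes lin: "linear_at \<Gamma> f p n m"
  obtains a b where "\<And>L. L \<in> \<L> \<Longrightarrow> p \<in> L \<Longrightarrow> slopes_at (f \<circ> c L) (\<tau> L p) (a L) (b L)"
    and "(\<Sum>i<n. m i) = (\<Sum>L | L \<in> \<L> \<and> p \<in> L. a L + b L)"
proof -
  obtain r \<gamma> where ch: "star_chart \<Gamma> p n r \<gamma>"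
    and f: "\<And>i t. i < n \<Longrightarrow> t \<in> {0..<r} \<Longrightarrow> f (\<gamma> i t) = f p + of_int (m i) * t"
    using lin unfolding linear_at_def by blast
  obtain idx \<epsilon> where \<epsilon>: "0 < \<epsilon>" "\<epsilon> \<le> r" and bij: "bij_betw idx (arms p) {..<n}"
    and idx: "\<And>A s. A \<in> arms p \<Longrightarrow> 0 < s \<Longrightarrow> s < \<epsilon> \<Longrightarrow> arm_point p A s = \<gamma> (idx A) s"
    using arms_star_chart[OF ch] by blast
  have fa: "f (arm_point p A s) = f p + of_int (m (idx A)) * s" if "A \<in> arms p" "0 < s" "s < \<epsilon>" for A s
    using idx[OF that] f[of "idx A" s] bij_betwE[OF bij] that \<epsilon> by auto
  show thesis
  proof (rule that[of "\<lambda>L. m (idx (L, 1))" "\<lambda>L. m (idx (L, - 1))"])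
    fix L assume L: "L \<in> \<L>" "p \<in> L"
    show "slopes_at (f \<circ> c L) (\<tau> L p) (m (idx (L, 1))) (m (idx (L, - 1)))"
    proof (rule slopes_atI[OF \<epsilon>(1)])
      fix s assume s: "0 < s" "s < \<epsilon>"
      show "(f \<circ> c L) (\<tau> L p + s) = (f \<circ> c L) (\<tau> L p) + of_int (m (idx (L, 1))) * s"
        using fa[of "(L, 1)" s] s L c_\<tau>[OF L] by (simp add: arms_def arm_point_def)
      show "(f \<circ> c L) (\<tau> L p - s) = (f \<circ> c L) (\<tau> L p) + of_int (m (idx (L, - 1))) * s"
        using fa[of "(L, - 1)" s] s L c_\<tau>[OF L] by (simp add: arms_def arm_point_def)
    qed
  next
    have "(\<Sum>i<n. m i) = (\<Sum>A\<in>arms p. m (idx A))"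
      using sum.reindex_bij_betw[OF bij, of m] by simp
    then show "(\<Sum>i<n. m i) = (\<Sum>L | L \<in> \<L> \<and> p \<in> L. m (idx (L, 1)) + m (idx (L, - 1)))"
      by (simp add: arms_sum)
  qed
qed

text \<open>The finitely many directions at \<open>p\<close> have a common radius of linearity, so
  any chart at \<open>p\<close>, suitably shrunk, shows linear arms.\<close>

lemma slopes_at_imp_linear_at:
  assumes "p \<in> \<Gamma>"
    and sl: "\<And>L. L \<in> \<L> \<Longrightarrow> p \<in> L \<Longrightarrow> \<exists>a b. slopes_at (f \<circ> c L) (\<tau> L p) a b"
  shows "\<exists>n m. linear_at \<Gamma> f p n m"
proof -
  obtain a b where ab: "\<And>L. L \<in> \<L> \<Longrightarrow> p \<in> L \<Longrightarrow> slopes_at (f \<circ> c L) (\<tau> L p) (a L) (b L)"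
    using sl by metis
  define h where "h A = (if snd A = 1 then a (fst A) else b (fst A))" for A :: "'a set \<times> real"
  have "\<forall>\<^sub>F s in at_right 0. f (arm_point p A s) = f p + of_int (h A) * s" if "A \<in> arms p" for A
  proof -
    from that have A: "fst A \<in> \<L>" "p \<in> fst A" "snd A = 1 \<or> snd A = - 1" unfolding arms_def by auto
    show ?thesis
      using ab[OF A(1,2)] unfolding slopes_at_def
      by (rule eventually_mono) (use A(3) c_\<tau>[OF A(1,2)] in \<open>auto simp: h_def arm_point_def\<close>)
  qed
  moreover have "finite (arms p)" unfolding arms_def using finite_loops by simp
  ultimately have "\<forall>\<^sub>F s in at_right 0. \<forall>A\<in>arms p. f (arm_point p A s) = f p + of_int (h A) * s"
    by (simp add: eventually_ball_finite)
  then obtain d where d: "d > 0"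
      "\<And>A s. A \<in> arms p \<Longrightarrow> 0 < s \<Longrightarrow> s < d \<Longrightarrow> f (arm_point p A s) = f p + of_int (h A) * s"
    unfolding eventually_at_right_field by auto
  obtain n r \<gamma> where ch: "star_chart \<Gamma> p n r \<gamma>" using star_chart_exists[OF assms(1)] by blast
  obtain idx \<epsilon> where \<epsilon>: "0 < \<epsilon>" "\<epsilon> \<le> r" and bij: "bij_betw idx (arms p) {..<n}"
    and idx: "\<And>A s. A \<in> arms p \<Longrightarrow> 0 < s \<Longrightarrow> s < \<epsilon> \<Longrightarrow> arm_point p A s = \<gamma> (idx A) s"
    using arms_star_chart[OF ch] by blast
  define m where "m i = h (inv_into (arms p) idx i)" for i
  have "linear_at \<Gamma> f p n m"
    unfolding linear_at_def
  proof (intro exI conjI allI impI ballI)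
    show "star_chart \<Gamma> p n (min \<epsilon> d) \<gamma>" using star_chart_shrink[OF ch] \<epsilon> d(1) by simp
    fix i t assume i: "i < n" and t: "t \<in> {0..<min \<epsilon> d}"
    define A where "A = inv_into (arms p) idx i"
    have A: "A \<in> arms p" "idx A = i"
      using bij i unfolding A_def bij_betw_def by (auto simp: inv_into_into f_inv_into_f)
    show "f (\<gamma> i t) = f p + of_int (m i) * t"
    proof (cases "t = 0")
      case True
      then show ?thesis using ch i unfolding star_chart_def by simp
    next
      case False
      then show ?thesis using d(2)[OF A(1), of t] idx[OF A(1), of t] A(2) t by (simp add: m_def A_def)
    qed
  qed
  then show ?thesis by blast
qed

text \<open>The share of \<open>L\<close> in the sum of outgoing slopes at \<open>p\<close>; where
  loops meet, the shares add up.\<close>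

definition lbend :: "('a \<Rightarrow> real) \<Rightarrow> 'a set \<Rightarrow> 'a \<Rightarrow> int" where
  "lbend f L p = bend (f \<circ> c L) (\<tau> L p)"

lemma lbend_c:
  assumes "L \<in> \<L>"
  shows "lbend f L (c L t) = bend (f \<circ> c L) t"
  using slopes_at_period[OF assms, of "\<tau> L (c L t)" t f] c_\<tau>[OF assms c_in[OF assms], of t]
  unfolding lbend_def bend_def by simp

text \<open>All admissible \<open>n\<close> and \<open>m\<close> give the same loopwise sum, which
  is why the definite description in \<open>ord_at\<close> denotes. The minus sign turns outgoing
  slopes into incoming ones.\<close>

lemma ord_at_eq:
  assumes lin: "linear_at \<Gamma> f p n m"
  shows "ord_at \<Gamma> f p = - (\<Sum>L | L \<in> \<L> \<and> p \<in> L. lbend f L p)"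
proof -
  have *: "(\<Sum>i<n. - m i) = - (\<Sum>L | L \<in> \<L> \<and> p \<in> L. lbend f L p)" if lin: "linear_at \<Gamma> f p n m" for n m
  proof -
    obtain a b where ab: "\<And>L. L \<in> \<L> \<Longrightarrow> p \<in> L \<Longrightarrow> slopes_at (f \<circ> c L) (\<tau> L p) (a L) (b L)"
      and s: "(\<Sum>i<n. m i) = (\<Sum>L | L \<in> \<L> \<and> p \<in> L. a L + b L)"
      using linear_at_imp_slopes_at[OF lin] by blast
    have "lbend f L p = a L + b L" if "L \<in> \<L>" "p \<in> L" for L
      unfolding lbend_def by (rule bend_eq[OF ab[OF that]])
    then show ?thesis by (simp add: sum_negf s)
  qed
  show ?thesis unfolding ord_at_def
  proof (rule the_equality)
    show "\<exists>n m. linear_at \<Gamma> f p n m \<and> - (\<Sum>L | L \<in> \<L> \<and> p \<in> L. lbend f L p) = (\<Sum>i<n. - m i)"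
      using lin * by metis
  qed (use * in auto)
qed

text \<open>Near \<open>p\<close> the function satisfies a Lipschitz bound whose constant is the sum
  of the absolute slopes. This supplies the continuity clause of \<open>PL\<close> for functions
  given by slopes on the loops.\<close>

lemma linear_at_isCont:
  assumes "linear_at \<Gamma> f p n m"
  shows "continuous (at p within \<Gamma>) f"
proof -
  obtain r \<gamma> where ch: "star_chart \<Gamma> p n r \<gamma>"
    and f: "\<And>i t. i < n \<Longrightarrow> t \<in> {0..<r} \<Longrightarrow> f (\<gamma> i t) = f p + of_int (m i) * t"
    using assms unfolding linear_at_def by blast
  have r: "r > 0" using ch unfolding star_chart_def by blast
  define M where "M = (\<Sum>i<n. \<bar>of_int (m i)\<bar> :: real)"
  have M0: "M \<ge> 0" unfolding M_def by (simp add: sum_nonneg)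
  have fM: "\<bar>f x - f p\<bar> \<le> M * dist x p" if x: "x \<in> \<Gamma>" "dist x p < r" for x
  proof (cases "x = p")
    case False
    obtain i where i: "i < n" "x = \<gamma> i (dist x p)" using star_chart_cover[OF ch x False] .
    have "f x = f p + of_int (m i) * dist x p" using f[OF i(1), of "dist x p"] i(2) x by simp
    then have "\<bar>f x - f p\<bar> = \<bar>of_int (m i)\<bar> * dist x p" by (simp add: abs_mult)
    also have "\<bar>of_int (m i)\<bar> \<le> M"
      unfolding M_def using i(1) member_le_sum[of i "{..<n}" "\<lambda>i. \<bar>of_int (m i)\<bar> :: real"] by simp
    finally show ?thesis by (simp add: mult_right_mono)
  qed simp
  show ?thesis
    unfolding continuous_within_eps_delta
  proof (intro allI impI)
    fix e :: real assume e: "e > 0"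
    show "\<exists>d>0. \<forall>x\<in>\<Gamma>. dist x p < d \<longrightarrow> dist (f x) (f p) < e"
    proof (intro exI[of _ "min r (e / (M + 1))"] conjI ballI impI)
      show "min r (e / (M + 1)) > 0" using r e M0 by simp
      fix x assume x: "x \<in> \<Gamma>" and d: "dist x p < min r (e / (M + 1))"
      have "\<bar>f x - f p\<bar> \<le> M * dist x p" using fM[OF x] d by simp
      also have "\<dots> \<le> (M + 1) * dist x p" by (simp add: mult_right_mono)
      also have "\<dots> < e" using d M0 by (simp add: pos_less_divide_eq mult.commute)
      finally show "dist (f x) (f p) < e" by (simp add: dist_real_def)
    qed
  qed
qed

lemma PL_iff_slopes_at:
  "PL \<Gamma> f \<longleftrightarrow> (\<forall>L\<in>\<L>. \<forall>t. \<exists>a b. slopes_at (f \<circ> c L) t a b)"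
proof
  assume PL: "PL \<Gamma> f"
  show "\<forall>L\<in>\<L>. \<forall>t. \<exists>a b. slopes_at (f \<circ> c L) t a b"
  proof (intro ballI allI)
    fix L t assume L: "L \<in> \<L>"
    have p: "c L t \<in> L" by (rule c_in[OF L])
    then have "c L t \<in> \<Gamma>" using L Union_loops by blast
    then obtain n m where "linear_at \<Gamma> f (c L t) n m" using PL unfolding PL_def by blast
    then obtain a b where "slopes_at (f \<circ> c L) (\<tau> L (c L t)) (a L) (b L)"
      using linear_at_imp_slopes_at[of f "c L t" n m] L p by metis
    then show "\<exists>a b. slopes_at (f \<circ> c L) t a b"
      using slopes_at_period[OF L, of "\<tau> L (c L t)" t] c_\<tau>[OF L p] by blast
  qed
next
  assume sl: "\<forall>L\<in>\<L>. \<forall>t. \<exists>a b. slopes_at (f \<circ> c L) t a b"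
  then have lin: "\<exists>n m. linear_at \<Gamma> f p n m" if "p \<in> \<Gamma>" for p
    using slopes_at_imp_linear_at[OF that] by blast
  then have "continuous_on \<Gamma> f"
    using linear_at_isCont unfolding continuous_on_eq_continuous_within by blast
  with lin show "PL \<Gamma> f" unfolding PL_def by blast
qed

text \<open>The working criterion: from here on star charts disappear, and principal divisors are
  recognized by slopes of periodic functions on the line.\<close>

lemma principal_iff:
  "principal \<Gamma> D \<longleftrightarrow> D \<in> Divs \<Gamma> \<and> (\<exists>f. (\<forall>L\<in>\<L>. \<forall>t. \<exists>a b. slopes_at (f \<circ> c L) t a b) \<and>
     (\<forall>p\<in>\<Gamma>. Poly_Mapping.lookup D p = - (\<Sum>L | L \<in> \<L> \<and> p \<in> L. lbend f L p)))"
proof -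
  have "ord_at \<Gamma> f p = - (\<Sum>L | L \<in> \<L> \<and> p \<in> L. lbend f L p)" if "PL \<Gamma> f" "p \<in> \<Gamma>" for f p
    using that ord_at_eq unfolding PL_def by blast
  then show ?thesis unfolding principal_def PL_iff_slopes_at[symmetric] by metis
qed

end


subsection \<open>Moving chips on a loop\<close>

lemma graph_path_imp_rtranclp:
  assumes "graph_path U adj P"
  shows "(\<lambda>u v. u \<in> U \<and> v \<in> U \<and> adj u v)\<^sup>*\<^sup>* (hd P) (last P)"
  using assms
proof (induction P)
  case (Cons u P)
  show ?case
  proof (cases "P = []")
    case False
    then have P: "graph_path U adj P" and u: "u \<in> U" "hd P \<in> U" "adj u (hd P)"
      using Cons.prems by (cases P; simp add: graph_path_def)+
    have "(\<lambda>u v. u \<in> U \<and> v \<in> U \<and> adj u v)\<^sup>*\<^sup>* u (last P)"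
      using Cons.IH[OF P] u by (intro converse_rtranclp_into_rtranclp[of _ u "hd P"]) auto
    then show ?thesis using False by simp
  qed simp
qed (simp add: graph_path_def)

text \<open>Loop erasure: when the walk returns to a visited vertex, the path is cut back to it, so
  the vertices stay distinct.\<close>

lemma rtranclp_imp_graph_path:
  assumes "(\<lambda>u v. u \<in> U \<and> v \<in> U \<and> adj u v)\<^sup>*\<^sup>* u v" "u \<in> U"
  shows "\<exists>P. graph_path U adj P \<and> hd P = u \<and> last P = v"
  using assms(1)
proof (induction rule: rtranclp_induct)
  case base
  then show ?case using assms(2) by (intro exI[of _ "[u]"]) (simp add: graph_path_def)
next
  case (step v w)
  then obtain P where P: "graph_path U adj P" "hd P = u" "last P = v" by blast
  show ?case
  proof (cases "w \<in> set P")
    case True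
    then obtain xs ys where xs: "P = xs @ w # ys" by (meson split_list)
    have "graph_path U adj (xs @ [w])"
      using P(1) unfolding xs graph_path_def by (auto simp: successively_append_iff)
    moreover have "hd (xs @ [w]) = u" using P(2) unfolding xs by (cases xs) auto
    ultimately show ?thesis by (intro exI[of _ "xs @ [w]"]) simp
  next
    case False
    then have "graph_path U adj (P @ [w])"
      using P step.hyps by (auto simp: graph_path_def successively_append_iff)
    moreover have "hd (P @ [w]) = u" using P by (simp add: graph_path_def)
    ultimately show ?thesis by (intro exI[of _ "P @ [w]"]) simp
  qed
qed

text \<open>The neighbour \<open>v\<close> is the penultimate vertex of the path from
  \<open>u\<close> to \<open>A\<close>; distinctness keeps everything before it away from
  \<open>A\<close>.\<close>

lemma graph_tree_branch_exists:
  assumes "graph_tree V adj" "A \<in> V" "u \<in> V" "u \<noteq> A"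
  shows "\<exists>v. v \<in> V - {A} \<and> adj v A \<and>
    (\<lambda>u v. u \<in> V - {A} \<and> v \<in> V - {A} \<and> adj u v)\<^sup>*\<^sup>* u v"
proof -
  obtain P where P: "graph_path V adj P" "hd P = u" "last P = A"
    using assms unfolding graph_tree_def by blast
  define xs where "xs = butlast P"
  have Px: "P = xs @ [A]" using P(1,3) unfolding xs_def graph_path_def by (metis append_butlast_last_id)
  have xs: "xs \<noteq> []" "hd xs = u" using P(2) assms(4) unfolding Px by (cases xs; auto)+
  have "graph_path (V - {A}) adj xs" "adj (last xs) A" "last xs \<in> V - {A}"
    using P(1) xs(1) unfolding Px graph_path_def by (auto simp: successively_append_iff)
  with graph_path_imp_rtranclp[of "V - {A}" adj xs] xs(2) show ?thesis by blast
qed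

text \<open>Two neighbours of \<open>A\<close> joined by a path avoiding \<open>A\<close> would
  close a cycle of length at least 3.\<close>

lemma graph_tree_branch_unique:
  assumes "graph_tree V adj" "A \<in> V" "symp adj" "u \<in> V - {A}" "adj u A" "adj v A"
    and "(\<lambda>u v. u \<in> V - {A} \<and> v \<in> V - {A} \<and> adj u v)\<^sup>*\<^sup>* u v"
  shows "u = v"
proof (rule ccontr)
  assume "u \<noteq> v"
  obtain P where P: "graph_path (V - {A}) adj P" "hd P = u" "last P = v"
    using rtranclp_imp_graph_path[OF assms(7,4)] by blast
  have "length P \<ge> 2" using P \<open>u \<noteq> v\<close> unfolding graph_path_def by (cases P; cases "tl P") auto
  moreover have "graph_path V adj (P @ [A])"
    using P assms(2,6) by (auto simp: graph_path_def successively_append_iff)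
  moreover have "adj (last (P @ [A])) (hd (P @ [A]))"
    using P assms(3,5) by (auto simp: graph_path_def dest: sympD)
  ultimately show False using assms(1) unfolding graph_tree_def
    by (metis (no_types, lifting) One_nat_def Suc_le_eq length_append_singleton less_Suc_eq_le numeral_2_eq_2 numeral_3_eq_3 not_less_eq_eq)
qed

lemma symp_loops_adj: "symp loops_adj"
  by (auto simp: symp_def loops_adj_def)

context param_tree_of_loops
begin

text \<open>Removing \<open>A\<close> splits the other loops into branches. Each meets
  \<open>A\<close> in exactly one point, and the extension carries the value of \<open>F\<close>
  there through the whole branch. Distinct branches are disjoint, as loops with a common point are
  equal or adjacent.\<close>

lemma extend_from_loop:
  assumes A: "A \<in> \<L>" and per: "\<And>s t. c A s = c A t \<Longrightarrow> F s = F t"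
  shows "\<exists>f. (\<forall>t. f (c A t) = F t) \<and> (\<forall>L\<in>\<L>. L \<noteq> A \<longrightarrow> (\<exists>y. \<forall>x\<in>L. f x = y))"
proof -
  define R where "R = (\<lambda>L M. L \<in> \<L> - {A} \<and> M \<in> \<L> - {A} \<and> loops_adj L M)"
  have "symp R" using symp_loops_adj unfolding R_def symp_def by blast
  then have symR: "R\<^sup>*\<^sup>* L M \<Longrightarrow> R\<^sup>*\<^sup>* M L" for L M
    by (rule sympD[OF symp_rtranclp])
  define attach where "attach L q \<longleftrightarrow> (\<exists>N. N \<in> \<L> - {A} \<and> R\<^sup>*\<^sup>* L N \<and> q \<in> N \<and> q \<in> A)" for L q
  have attach_unique: "q = q'" if q: "attach L q" and q': "attach L q'" for L q q'
  proof -
    obtain N N' where N: "N \<in> \<L> - {A}" "R\<^sup>*\<^sup>* L N" "q \<in> N" "q \<in> A"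
      and N': "N' \<in> \<L> - {A}" "R\<^sup>*\<^sup>* L N'" "q' \<in> N'" "q' \<in> A"
      using q q' unfolding attach_def by blast
    have "R\<^sup>*\<^sup>* N N'" using symR[OF N(2)] N'(2) by (rule rtranclp_trans)
    moreover have "loops_adj N A" "loops_adj N' A" using N N' by (auto simp: loops_adj_def)
    ultimately have "N = N'"
      unfolding R_def by (intro graph_tree_branch_unique[OF graph_tree_loops A symp_loops_adj N(1)])
    then show ?thesis using loops_meet[of N A q q'] N N' A by blast
  qed
  define Q where "Q L = (SOME q. attach L q)" for L
  have Q: "attach L (Q L)" if L: "L \<in> \<L>" "L \<noteq> A" for L
  proof -
    have "\<exists>N. N \<in> \<L> - {A} \<and> loops_adj N A \<and> R\<^sup>*\<^sup>* L N"
      unfolding R_def by (rule graph_tree_branch_exists[OF graph_tree_loops A L])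
    then obtain N where "N \<in> \<L> - {A}" "loops_adj N A" "R\<^sup>*\<^sup>* L N" by blast
    then have "\<exists>q. attach L q" unfolding attach_def loops_adj_def by blast
    then show ?thesis unfolding Q_def by (rule someI_ex)
  qed
  \<comment> \<open>Outside \<open>A\<close> a point may lie on several loops; they belong to one
    branch, so the choice among them does not affect the value.\<close>
  define f where "f x = F (\<tau> A (if x \<in> A then x else Q (SOME L. L \<in> \<L> \<and> x \<in> L)))" for x
  show ?thesis
  proof (intro exI[of _ f] conjI allI ballI impI)
    show "f (c A t) = F t" for t
      using c_in[OF A, of t] per[OF c_\<tau>[OF A c_in[OF A, of t]]] by (simp add: f_def)
    fix L assume L: "L \<in> \<L>" "L \<noteq> A"
    have "f x = F (\<tau> A (Q L))" if x: "x \<in> L" for x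
    proof (cases "x \<in> A")
      case True
      then have "attach L x" unfolding attach_def using L x by blast
      then have "x = Q L" using Q[OF L] attach_unique by blast
      then show ?thesis using True by (simp add: f_def)
    next
      case False
      define M where "M = (SOME L. L \<in> \<L> \<and> x \<in> L)"
      have M: "M \<in> \<L> \<and> x \<in> M" unfolding M_def by (rule someI[of _ L]) (use L x in blast)
      then have "M \<noteq> A" using False by blast
      have "R\<^sup>*\<^sup>* M L"
        using M \<open>M \<noteq> A\<close> L x by (cases "M = L") (auto simp: R_def loops_adj_def)
      then have "attach M (Q L)"
        using Q[OF L] unfolding attach_def by (meson rtranclp_trans)
      then have "Q M = Q L" using attach_unique[OF Q] M \<open>M \<noteq> A\<close> by blast
      then show ?thesis using False by (simp add: f_def M_def)
    qed
    then show "\<exists>y. \<forall>x\<in>L. f x = y" by blast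
  qed
qed

text \<open>The sufficient half of Abel's theorem on a circle. Over a period the function
  \<open>F\<close> changes by \<open>a + b - e - x = 0\<close>, so it descends to the loop. The
  translates at \<open>a\<close> and \<open>b\<close> carry a minus sign because incoming slopes are
  counted: a chip of coefficient 1 is a concave kink.\<close>

lemma principal_four_points:
  assumes A: "A \<in> \<L>" and sum: "a + b = e + x"
  shows "principal \<Gamma> (Poly_Mapping.single (c A a) 1 + Poly_Mapping.single (c A b) 1
           - Poly_Mapping.single (c A e) 1 - Poly_Mapping.single (c A x) 1)"
    (is "principal \<Gamma> ?D")
proof -
  let ?l = "l A"
  define F where "F t = (- theta ?l (t - a) + - theta ?l (t - b)) + (theta ?l (t - e) + theta ?l (t - x))" for t
  have Fl: "F (t + ?l) = F t" for t
  proof -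
    have "theta ?l (t + ?l - u) = theta ?l (t - u) + (t - u)" for u
      using theta_add_period[OF l_pos[OF A], of "t - u"] by (simp add: algebra_simps)
    then show ?thesis unfolding F_def using sum by simp
  qed
  have Fln: "F (t + of_nat n * ?l) = F t" for t n
  proof (induction n)
    case (Suc n)
    then show ?case using Fl[of "t + of_nat n * ?l"] by (simp add: algebra_simps)
  qed simp
  have Flk: "F (t + of_int k * ?l) = F t" for t and k :: int
  proof (cases k)
    case (nonneg n)
    then show ?thesis using Fln by simp
  next
    case (neg n)
    then have "t + of_int k * ?l + of_nat (Suc n) * ?l = t" unfolding neg by (simp add: algebra_simps)
    then show ?thesis using Fln[of "t + of_int k * ?l" "Suc n"] by metis
  qed
  have per: "F s = F t" if st: "c A s = c A t" for s t
  proof -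
    obtain k :: int where "s - t = of_int k * ?l" using st c_eq_iff[OF A] by blast
    then have "s = t + of_int k * ?l" by linarith
    then show ?thesis using Flk[of t k] by metis
  qed
  have "\<exists>f. (\<forall>t. f (c A t) = F t) \<and> (\<forall>L\<in>\<L>. L \<noteq> A \<longrightarrow> (\<exists>y. \<forall>x\<in>L. f x = y))"
    by (rule extend_from_loop[OF A per])
  then obtain f where fA: "\<forall>t. f (c A t) = F t"
    and fL: "\<forall>L\<in>\<L>. L \<noteq> A \<longrightarrow> (\<exists>y. \<forall>x\<in>L. f x = y)"
    by blast
  have fA': "f \<circ> c A = F" using fA by auto
  have th: "\<exists>p q. slopes_at (\<lambda>t. theta ?l (t - u)) t p q \<and> p + q = (if c A u = c A t then 1 else 0)"
    for u t
    using theta_slopes[OF l_pos[OF A], of "t - u"] c_eq_iff[OF A, of t u]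
    by (auto simp: slopes_at_shift eq_commute)
  have Fs: "\<exists>p q. slopes_at F t p q \<and> p + q = - Poly_Mapping.lookup ?D (c A t)" for t
  proof -
    obtain p1 q1 where s1: "slopes_at (\<lambda>t. theta ?l (t - a)) t p1 q1"
      "p1 + q1 = (if c A a = c A t then 1 else 0)"
      using th by blast
    obtain p2 q2 where s2: "slopes_at (\<lambda>t. theta ?l (t - b)) t p2 q2"
      "p2 + q2 = (if c A b = c A t then 1 else 0)"
      using th by blast
    obtain p3 q3 where s3: "slopes_at (\<lambda>t. theta ?l (t - e)) t p3 q3"
      "p3 + q3 = (if c A e = c A t then 1 else 0)"
      using th by blast
    obtain p4 q4 where s4: "slopes_at (\<lambda>t. theta ?l (t - x)) t p4 q4"
      "p4 + q4 = (if c A x = c A t then 1 else 0)"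
      using th by blast
    have "slopes_at F t ((- p1 + - p2) + (p3 + p4)) ((- q1 + - q2) + (q3 + q4))"
      unfolding F_def by (intro slopes_at_add slopes_at_uminus s1(1) s2(1) s3(1) s4(1))
    moreover have "((- p1 + - p2) + (p3 + p4)) + ((- q1 + - q2) + (q3 + q4))
        = - Poly_Mapping.lookup ?D (c A t)"
    proof -
      have "((- p1 + - p2) + (p3 + p4)) + ((- q1 + - q2) + (q3 + q4))
        = - (p1 + q1) - (p2 + q2) + (p3 + q3) + (p4 + q4)" by simp
      also have "\<dots> = - Poly_Mapping.lookup ?D (c A t)"
        unfolding s1 s2 s3 s4 by (simp add: lookup_add lookup_minus lookup_single when_def)
      finally show ?thesis .
    qed
    ultimately show ?thesis by (intro exI conjI)
  qed
  have const: "slopes_at (f \<circ> c L) t 0 0" if L: "L \<in> \<L>" "L \<noteq> A" for L t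
  proof -
    obtain y where "\<forall>x\<in>L. f x = y" using fL L by blast
    then have "f \<circ> c L = (\<lambda>_. y)" using c_in[OF L(1)] by auto
    then show ?thesis by (simp add: slopes_at_const)
  qed
  show ?thesis unfolding principal_iff
  proof (intro conjI exI[of _ f] ballI allI)
    have "Poly_Mapping.keys ?D \<subseteq> {c A a, c A b, c A e, c A x}"
      by (auto simp: in_keys_iff lookup_add lookup_minus lookup_single when_def split: if_splits)
    then show "?D \<in> Divs \<Gamma>" using c_in[OF A] A Union_loops unfolding Divs_def by blast
  next
    fix L t assume "L \<in> \<L>"
    then show "\<exists>a b. slopes_at (f \<circ> c L) t a b"
      using const[of L t] Fs[of t] fA' by (cases "L = A") auto
  next
    fix p assume "p \<in> \<Gamma>"
    \<comment> \<open>On the other loops \<open>f\<close> is constant, so only \<open>A\<close>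
      contributes, also at points where branches are attached to \<open>A\<close>.\<close>
    have "(\<Sum>L | L \<in> \<L> \<and> p \<in> L. lbend f L p) = (\<Sum>L | L \<in> \<L> \<and> p \<in> L. if L = A then lbend f A p else 0)"
      using bend_eq[OF const] by (intro sum.cong) (simp_all add: lbend_def)
    also have "\<dots> = (if p \<in> A then lbend f A p else 0)"
      using finite_loops A by (simp add: sum.delta)
    also have "\<dots> = - Poly_Mapping.lookup ?D p"
    proof (cases "p \<in> A")
      case True
      then obtain t where t: "p = c A t" using c_\<tau>[OF A] by metis
      obtain a' b' where "slopes_at F t a' b'" "a' + b' = - Poly_Mapping.lookup ?D (c A t)" using Fs by blast
      then have "lbend f A p = - Poly_Mapping.lookup ?D p"
        unfolding t lbend_c[OF A] fA' using bend_eq by metis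
      then show ?thesis using True by simp
    next
      case False
      then have "c A u \<noteq> p" for u using c_in[OF A] by blast
      then have "Poly_Mapping.lookup (Poly_Mapping.single (c A u) 1) p = (0::int)" for u
        by (intro lookup_single_not_eq)
      then show ?thesis using False by (simp only: lookup_add lookup_minus) simp
    qed
    finally show "Poly_Mapping.lookup ?D p = - (\<Sum>L | L \<in> \<L> \<and> p \<in> L. lbend f L p)" by simp
  qed
qed

end

section \<open>Degree and effectivity of divisors\<close>

lemma div_degree_superset:
  assumes "finite S" "Poly_Mapping.keys D \<subseteq> S"
  shows "div_degree D = (\<Sum>p\<in>S. Poly_Mapping.lookup D p)"
  unfolding div_degree_def using assms by (intro sum.mono_neutral_left) (auto simp: in_keys_iff)

lemma div_degree_add: "div_degree (D + E) = div_degree D + div_degree E"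
proof -
  let ?S = "Poly_Mapping.keys D \<union> Poly_Mapping.keys E"
  have "Poly_Mapping.keys (D + E) \<subseteq> ?S" by (rule Poly_Mapping.keys_add)
  then have "div_degree (D + E) = (\<Sum>p\<in>?S. Poly_Mapping.lookup (D + E) p)"
    by (intro div_degree_superset) auto
  also have "\<dots> = (\<Sum>p\<in>?S. Poly_Mapping.lookup D p) + (\<Sum>p\<in>?S. Poly_Mapping.lookup E p)"
    by (simp add: lookup_add sum.distrib)
  also have "\<dots> = div_degree D + div_degree E"
    using div_degree_superset[of ?S D] div_degree_superset[of ?S E] by simp
  finally show ?thesis .
qed

lemma div_degree_diff: "div_degree (D - E) = div_degree D - div_degree E"
  using div_degree_add[of "D - E" E] by simp

lemma div_degree_single: "div_degree (Poly_Mapping.single p k) = k"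
  using div_degree_superset[of "{p}" "Poly_Mapping.single p k"] by simp

lemma Divs_add: "D \<in> Divs \<Gamma> \<Longrightarrow> E \<in> Divs \<Gamma> \<Longrightarrow> D + E \<in> Divs \<Gamma>"
  unfolding Divs_def using Poly_Mapping.keys_add[of D E] by blast

lemma Divs_diff: "D \<in> Divs \<Gamma> \<Longrightarrow> E \<in> Divs \<Gamma> \<Longrightarrow> D - E \<in> Divs \<Gamma>"
  unfolding Divs_def using Poly_Mapping.keys_diff[of D E] by blast

lemma Divs_single: "p \<in> \<Gamma> \<Longrightarrow> Poly_Mapping.single p k \<in> Divs \<Gamma>"
  unfolding Divs_def by simp

lemma Divs_0: "0 \<in> Divs \<Gamma>"
  unfolding Divs_def by simp

lemma effective_add: "effective D \<Longrightarrow> effective E \<Longrightarrow> effective (D + E)"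
  by (simp add: effective_def lookup_add)

lemma effective_single: "k \<ge> 0 \<Longrightarrow> effective (Poly_Mapping.single p k)"
  by (simp add: effective_def lookup_single when_def)

lemma effective_degree_nonneg: "effective D \<Longrightarrow> div_degree D \<ge> 0"
  unfolding effective_def div_degree_def by (simp add: sum_nonneg)

text \<open>Removing a chip at a point of the support leaves an effective divisor of degree zero,
  which is zero.\<close>

lemma effective_degree_1:
  assumes "effective D" "div_degree D = 1"
  shows "\<exists>p. D = Poly_Mapping.single p 1"
proof -
  have "Poly_Mapping.keys D \<noteq> {}" using assms(2) by (auto simp: div_degree_def)
  then obtain p where p: "p \<in> Poly_Mapping.keys D" by blast
  define E where "E = D - Poly_Mapping.single p 1"
  have "effective E"
    using assms(1) p unfolding effective_def E_def
    by (auto simp: lookup_minus lookup_single when_def in_keys_iff order_less_le)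
      (metis add.commute add_0 int_one_le_iff_zero_less order_less_le)
  moreover have "div_degree E = 0" unfolding E_def by (simp add: div_degree_diff div_degree_single assms(2))
  ultimately have "\<forall>q\<in>Poly_Mapping.keys E. Poly_Mapping.lookup E q = 0"
    unfolding effective_def div_degree_def by (subst (asm) sum_nonneg_eq_0_iff) auto
  then have "E = 0" by (auto simp: in_keys_iff intro!: poly_mapping_eqI)
  then show ?thesis unfolding E_def by auto
qed

context param_tree_of_loops
begin

lemma principal_0: "principal \<Gamma> 0"
  unfolding principal_iff
proof (intro conjI exI[of _ "\<lambda>_. 0"] ballI allI)
  have s: "slopes_at ((\<lambda>_. 0) \<circ> c L) t 0 0" for L t
    using slopes_at_const[of 0] by (simp add: comp_def)
  then show "\<exists>a b. slopes_at ((\<lambda>_. 0) \<circ> c L) t a b" for L t by blast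
  show "Poly_Mapping.lookup 0 p = - (\<Sum>L | L \<in> \<L> \<and> p \<in> L. lbend (\<lambda>_. 0) L p)" for p
    using bend_eq[OF s] by (simp add: lbend_def)
qed (rule Divs_0)

lemma principal_add:
  assumes "principal \<Gamma> D" "principal \<Gamma> E"
  shows "principal \<Gamma> (D + E)"
proof -
  obtain f where f: "\<forall>L\<in>\<L>. \<forall>t. \<exists>a b. slopes_at (f \<circ> c L) t a b"
    "\<forall>p\<in>\<Gamma>. Poly_Mapping.lookup D p = - (\<Sum>L | L \<in> \<L> \<and> p \<in> L. lbend f L p)"
    using assms(1) unfolding principal_iff by blast
  obtain g where g: "\<forall>L\<in>\<L>. \<forall>t. \<exists>a b. slopes_at (g \<circ> c L) t a b"
    "\<forall>p\<in>\<Gamma>. Poly_Mapping.lookup E p = - (\<Sum>L | L \<in> \<L> \<and> p \<in> L. lbend g L p)"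
    using assms(2) unfolding principal_iff by blast
  let ?h = "\<lambda>x. f x + g x"
  have comp: "?h \<circ> c L = (\<lambda>t. (f \<circ> c L) t + (g \<circ> c L) t)" for L by auto
  have h: "(\<exists>a b. slopes_at (?h \<circ> c L) t a b) \<and>
      bend (?h \<circ> c L) t = bend (f \<circ> c L) t + bend (g \<circ> c L) t" if L: "L \<in> \<L>" for L t
  proof -
    obtain a b where ab: "slopes_at (f \<circ> c L) t a b" using f(1) L by blast
    obtain a' b' where ab': "slopes_at (g \<circ> c L) t a' b'" using g(1) L by blast
    have "slopes_at (?h \<circ> c L) t (a + a') (b + b')" unfolding comp by (rule slopes_at_add[OF ab ab'])
    with bend_eq[OF this] bend_eq[OF ab] bend_eq[OF ab'] show ?thesis by auto
  qed
  have "lbend ?h L p = lbend f L p + lbend g L p" if "L \<in> \<L>" for L p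
    using h[OF that] by (simp add: lbend_def)
  then have "(\<Sum>L | L \<in> \<L> \<and> p \<in> L. lbend ?h L p) =
      (\<Sum>L | L \<in> \<L> \<and> p \<in> L. lbend f L p) + (\<Sum>L | L \<in> \<L> \<and> p \<in> L. lbend g L p)" for p
    by (simp add: sum.distrib[symmetric])
  then have "\<forall>p\<in>\<Gamma>. Poly_Mapping.lookup (D + E) p = - (\<Sum>L | L \<in> \<L> \<and> p \<in> L. lbend ?h L p)"
    using f(2) g(2) by (simp add: lookup_add)
  moreover have "D + E \<in> Divs \<Gamma>" using assms Divs_add unfolding principal_def by blast
  ultimately show ?thesis unfolding principal_iff using h by blast
qed

text \<open>After exchanging the sums over points and loops, each loop contributes the total bend of
  a periodic function, which is zero.\<close>

lemma div_degree_principal: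
  assumes "principal \<Gamma> D"
  shows "div_degree D = 0"
proof -
  obtain f where sl: "\<And>L t. L \<in> \<L> \<Longrightarrow> \<exists>a b. slopes_at (f \<circ> c L) t a b"
    and D: "\<And>p. p \<in> \<Gamma> \<Longrightarrow> Poly_Mapping.lookup D p = - (\<Sum>L | L \<in> \<L> \<and> p \<in> L. lbend f L p)"
    using assms unfolding principal_iff by blast
  define S where "S L = {p \<in> L. lbend f L p \<noteq> 0}" for L
  have S: "finite (S L)" "sum (lbend f L) (S L) = 0" if L: "L \<in> \<L>" for L
  proof -
    let ?T = "{t \<in> {0<..l L}. bend (f \<circ> c L) t \<noteq> 0}"
    have per: "(f \<circ> c L) (t + l L) = (f \<circ> c L) t" for t using c_periodic[OF L] by simp
    have inj: "inj_on (c L) ?T" using bij_c[OF L] by (auto simp: bij_betw_def intro: inj_on_subset)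
    have im: "S L = c L ` ?T"
    proof (intro equalityI subsetI)
      fix p assume p: "p \<in> S L"
      then have "p \<in> c L ` {0<..l L}" using bij_betw_imp_surj_on[OF bij_c[OF L]] by (simp add: S_def)
      then obtain t where t: "t \<in> {0<..l L}" "p = c L t" by blast
      then have "t \<in> ?T" using p lbend_c[OF L, of f t] by (simp add: S_def)
      with t(2) show "p \<in> c L ` ?T" by blast
    next
      fix p assume "p \<in> c L ` ?T"
      then obtain t where "t \<in> ?T" "p = c L t" by blast
      then show "p \<in> S L" using c_in[OF L, of t] lbend_c[OF L, of f t] by (simp add: S_def)
    qed
    show "finite (S L)"
      unfolding im by (rule finite_imageI) (rule sum_bend_periodic(1)[OF sl[OF L] per l_pos[OF L]])
    have "sum (lbend f L) (S L) = (\<Sum>t\<in>?T. bend (f \<circ> c L) t)"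
      unfolding im by (subst sum.reindex[OF inj]) (simp only: o_def[of "lbend f L"] lbend_c[OF L])
    also have "\<dots> = 0" by (rule sum_bend_periodic(2)[OF sl[OF L] per l_pos[OF L]])
    finally show "sum (lbend f L) (S L) = 0" .
  qed
  \<comment> \<open>Bends of different loops may cancel at a common point, so the bend points are
    added to the support of \<open>D\<close>.\<close>
  define U where "U = Poly_Mapping.keys D \<union> \<Union>(S ` \<L>)"
  have finU: "finite U" unfolding U_def using S(1) finite_loops by auto
  have "Poly_Mapping.keys D \<subseteq> \<Gamma>" using assms unfolding principal_def Divs_def by blast
  then have U\<Gamma>: "U \<subseteq> \<Gamma>" unfolding U_def S_def Union_loops by blast
  have "div_degree D = (\<Sum>p\<in>U. Poly_Mapping.lookup D p)"
    by (rule div_degree_superset[OF finU]) (simp add: U_def)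
  also have "\<dots> = (\<Sum>p\<in>U. - (\<Sum>L | L \<in> \<L> \<and> p \<in> L. lbend f L p))"
    using D U\<Gamma> by (intro sum.cong) auto
  also have "\<dots> = - (\<Sum>p\<in>U. \<Sum>L\<in>\<L>. if p \<in> L then lbend f L p else 0)"
    using finite_loops by (simp add: sum_negf sum.inter_filter)
  also have "(\<Sum>p\<in>U. \<Sum>L\<in>\<L>. if p \<in> L then lbend f L p else 0)
      = (\<Sum>L\<in>\<L>. \<Sum>p\<in>U. if p \<in> L then lbend f L p else 0)"
    by (rule sum.swap)
  also have "\<dots> = (\<Sum>L\<in>\<L>. sum (lbend f L) (S L))"
  proof (rule sum.cong[OF refl])
    fix L assume L: "L \<in> \<L>"
    have "sum (lbend f L) (S L) = (\<Sum>p\<in>S L. if p \<in> L then lbend f L p else 0)"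
      by (rule sum.cong) (auto simp: S_def)
    also have "\<dots> = (\<Sum>p\<in>U. if p \<in> L then lbend f L p else 0)"
      using L finU by (intro sum.mono_neutral_left) (auto simp: U_def S_def)
    finally show "(\<Sum>p\<in>U. if p \<in> L then lbend f L p else 0) = sum (lbend f L) (S L)" by simp
  qed
  also have "\<dots> = 0" using S(2) by simp
  finally show ?thesis by simp
qed

end


subsection \<open>Rank one divisors from a centre of the tree\<close>

abbreviation chips :: "nat \<Rightarrow> 'a \<Rightarrow> 'a \<Rightarrow>\<^sub>0 int" where
  "chips k p \<equiv> Poly_Mapping.single p (int k)"

lemma chips_Suc: "chips (Suc k) p = chips k p + Poly_Mapping.single p 1"
  by (simp add: single_add[symmetric] add.commute)

text \<open>A walk of \<open>k\<close> loops starting at \<open>v\<close>, the loop containing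
  \<open>v\<close> included in the count. Consecutive loops only have to intersect, so a nonempty
  loop may be repeated; this is what turns \<open>k\<close> into an upper bound in
  \<open>near_mono\<close>.\<close>

inductive near :: "'a set set \<Rightarrow> 'a \<Rightarrow> nat \<Rightarrow> 'a set \<Rightarrow> bool" for \<L> v where
  base: "L \<in> \<L> \<Longrightarrow> v \<in> L \<Longrightarrow> near \<L> v 1 L"
| step: "near \<L> v k L \<Longrightarrow> L' \<in> \<L> \<Longrightarrow> L \<inter> L' \<noteq> {} \<Longrightarrow> near \<L> v (Suc k) L'"

lemma near_in: "near \<L> v k L \<Longrightarrow> L \<in> \<L>"
  by (induction rule: near.induct) auto

lemma near_mono:
  assumes "near \<L> v k L" "k \<le> k'" "L \<noteq> {}"
  shows "near \<L> v k' L"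
  using assms(2)
proof (induction rule: dec_induct)
  case base
  then show ?case using assms(1) .
next
  case (step n)
  then show ?case using near.step[OF step.IH near_in[OF step.IH]] assms(3) by simp
qed

lemma near_path:
  assumes "set P \<subseteq> \<L>" "successively loops_adj P" "P \<noteq> []" "v \<in> hd P"
  shows "near \<L> v (length P) (last P)"
  using assms
proof (induction P rule: rev_induct)
  case (snoc L P)
  show ?case
  proof (cases "P = []")
    case True
    then show ?thesis using snoc.prems near.base[of L \<L> v] by simp
  next
    case False
    then have "near \<L> v (length P) (last P)" "loops_adj (last P) L"
      using snoc by (auto simp: successively_append_iff)
    then show ?thesis using near.step[of \<L> v "length P" "last P" L] snoc.prems
      by (simp add: loops_adj_def)
  qed
qed simp

lemma longest_graph_path:
  assumes "finite V" "V \<noteq> {}"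
  shows "\<exists>P. graph_path V adj P \<and> (\<forall>Q. graph_path V adj Q \<longrightarrow> length Q \<le> length P)"
proof -
  obtain u where "u \<in> V" using assms(2) by blast
  then have "graph_path V adj [u]" by (simp add: graph_path_def)
  moreover have "\<forall>P. graph_path V adj P \<longrightarrow> length P < Suc (card V)"
    using assms(1) card_mono by (fastforce simp: graph_path_def distinct_card[symmetric] less_Suc_eq_le)
  ultimately show ?thesis
    by (rule ex_has_greatest_nat)
qed

text \<open>The path from the end of \<open>P\<close> to \<open>u\<close> is cut at its last vertex
  on \<open>P\<close>, so the rest \<open>T\<close> never returns to \<open>P\<close>. It is empty
  exactly when \<open>u\<close> lies on \<open>P\<close>.\<close>

lemma graph_tree_branch_off:
  assumes tree: "graph_tree V adj" and P: "graph_path V adj P" and "u \<in> V"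
  obtains i T where "i < length P" "set T \<subseteq> V" "distinct T" "set T \<inter> set P = {}"
    "successively adj (P ! i # T)" "last (P ! i # T) = u"
proof -
  have "P \<noteq> []" "last P \<in> V" using P by (auto simp: graph_path_def)
  then obtain Q where Q: "graph_path V adj Q" "hd Q = last P" "last Q = u"
    using tree assms(3) unfolding graph_tree_def by blast
  have "\<exists>x\<in>set Q. x \<in> set P" using Q \<open>P \<noteq> []\<close> by (metis graph_path_def hd_in_set last_in_set)
  then obtain xs x T where x: "Q = xs @ x # T" "x \<in> set P" "\<forall>y\<in>set T. y \<notin> set P"
    using split_list_last_prop[of Q "\<lambda>x. x \<in> set P"] by blast
  obtain i where i: "i < length P" "P ! i = x" using x(2) by (meson in_set_conv_nth)
  show thesis
  proof (rule that[of i T])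
    show "set T \<subseteq> V" "distinct T" "successively adj (P ! i # T)" "last (P ! i # T) = u"
      using Q unfolding graph_path_def x(1) i(2) by (auto simp: successively_append_iff)
    show "set T \<inter> set P = {}" using x(3) by blast
  qed (rule i(1))
qed

text \<open>Following \<open>P\<close> up to index \<open>i\<close> and then \<open>T\<close> gives
  another path, so by maximality \<open>T\<close> is no longer than the part of \<open>P\<close>
  beyond \<open>i\<close>. Starting at index \<open>b\<close> instead of 0 saves \<open>b\<close>
  loops.\<close>

lemma near_longest_path:
  assumes P: "graph_path \<L> loops_adj P" and max: "\<And>Q. graph_path \<L> loops_adj Q \<Longrightarrow> length Q \<le> length P"
    and i: "b \<le> i" "i < length P" and v: "v \<in> P ! b"
    and T: "set T \<subseteq> \<L>" "distinct T" "set T \<inter> set P = {}" "successively loops_adj (P ! i # T)"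
    and ne: "{} \<notin> \<L>"
  shows "near \<L> v (length P - b) (last (P ! i # T))"
proof -
  define Q where "Q = take (Suc i) P @ T"
  have ti: "take (Suc i) P = take i P @ [P ! i]" using i(2) by (rule take_Suc_conv_app_nth)
  have "successively loops_adj (take (Suc i) P @ drop (Suc i) P)" using P by (simp add: graph_path_def)
  then have "successively loops_adj (take i P @ [P ! i])"
    unfolding ti successively_append_iff by blast
  then have succQ: "successively loops_adj Q"
    using T(4) unfolding Q_def ti by (auto simp: successively_append_iff successively_Cons)
  have "set (take (Suc i) P) \<subseteq> set P" by (rule set_take_subset)
  then have "graph_path \<L> loops_adj Q"
    using P T i(2) succQ unfolding graph_path_def by (auto simp: Q_def)
  from max[OF this] have len: "Suc i + length T \<le> length P" using i(2) by (simp add: Q_def)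
  let ?W = "drop b Q"
  have hW: "?W = drop b (take (Suc i) P) @ T" using i by (simp add: Q_def)
  have "?W \<noteq> []" using i by (simp add: hW)
  have "hd ?W = P ! b" using i by (simp add: hW hd_drop_conv_nth)
  moreover have "last ?W = last (P ! i # T)"
    using i by (cases T) (simp_all add: hW ti last_append)
  moreover have "successively loops_adj ?W"
    using succQ append_take_drop_id[of b Q] by (metis successively_append_iff)
  moreover have "set ?W \<subseteq> \<L>"
    using \<open>graph_path \<L> loops_adj Q\<close> set_drop_subset[of b Q] by (auto simp: graph_path_def)
  ultimately have W: "near \<L> v (length ?W) (last (P ! i # T))"
    using near_path[of ?W \<L> v] \<open>?W \<noteq> []\<close> v by simp
  have "length ?W \<le> length P - b" using len i by (simp add: hW)
  moreover have "last (P ! i # T) \<noteq> {}" using near_in[OF W] ne by metis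
  ultimately show ?thesis by (rule near_mono[OF W])
qed

lemma graph_path_rev: "symp adj \<Longrightarrow> graph_path V adj P \<Longrightarrow> graph_path V adj (rev P)"
  unfolding graph_path_def by (auto elim: successively_mono dest: sympD)

text \<open>
  The centre of a longest path: the middle loop if the path has odd length, the common point of the
  two middle loops otherwise.
\<close>

lemma tree_of_loops_centre:
  assumes tree: "graph_tree \<L> loops_adj" and P: "graph_path \<L> loops_adj P"
    and max: "\<And>Q. graph_path \<L> loops_adj Q \<Longrightarrow> length Q \<le> length P" and ne: "{} \<notin> \<L>"
  obtains v where "v \<in> \<Union>\<L>" "\<And>L. L \<in> \<L> \<Longrightarrow> near \<L> v ((length P + 1) div 2) L"
proof -
  define m where "m = length P"
  have m: "m > 0" using P by (simp add: m_def graph_path_def)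
  \<comment> \<open>The two middle indices, equal when \<open>m\<close> is odd. Reversing the path
    exchanges them, since \<open>b = m - Suc a\<close>.\<close>
  define a b where "a = (m - 1) div 2" and "b = m div 2"
  have ab: "a \<le> b" "b \<le> Suc a" "b < m" "a < m" "m - b = (m + 1) div 2" "b = m - Suc a"
    using m unfolding a_def b_def by presburger+
  have P_in: "P ! i \<in> \<L>" if "i < m" for i using P that by (auto simp: graph_path_def m_def)
  have "\<exists>v. v \<in> P ! a \<and> v \<in> P ! b"
  proof (cases "a = b")
    case True
    then show ?thesis using P_in[of b] ab ne by (metis all_not_in_conv)
  next
    case False
    then have "b = Suc a" using ab by simp
    then have "loops_adj (P ! a) (P ! b)"
      using successively_nth[of loops_adj P a] P ab by (simp add: graph_path_def m_def)
    then show ?thesis by (auto simp: loops_adj_def)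
  qed
  then obtain v where v: "v \<in> P ! a" "v \<in> P ! b" by blast
  show thesis
  proof (rule that[of v])
    show "v \<in> \<Union>\<L>" using v P_in ab by blast
    fix L assume "L \<in> \<L>"
    then obtain i T where i: "i < length P" and T: "set T \<subseteq> \<L>" "distinct T" "set T \<inter> set P = {}"
      "successively loops_adj (P ! i # T)" "last (P ! i # T) = L"
      by (rule graph_tree_branch_off[OF tree P])
    show "near \<L> v ((length P + 1) div 2) L"
    proof (cases "b \<le> i")
      case True
      then show ?thesis
        using near_longest_path[OF P max True i v(2) T(1-4) ne] ab(5) T(5) by (simp add: m_def)
    next
      case False
      \<comment> \<open>A branch leaving before \<open>b\<close> is seen from the reversed path:
        there it leaves at \<open>b\<close> or later, and \<open>v\<close>, being a point of
        \<open>P ! a\<close>, again lies on the loop with index \<open>b\<close>.\<close>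
      let ?i = "m - Suc i"
      have rev: "rev P ! (m - Suc j) = P ! j" if "j < m" for j
        using that by (simp add: rev_nth m_def)
      have "near \<L> v (length (rev P) - b) (last (rev P ! ?i # T))"
      proof (rule near_longest_path)
        show "graph_path \<L> loops_adj (rev P)" by (rule graph_path_rev[OF symp_loops_adj P])
        show "b \<le> ?i" using False ab(2,6) by linarith
        show "?i < length (rev P)" using m by (simp add: m_def)
        show "v \<in> rev P ! b" using v(1) rev[of a] ab by simp
        show "successively loops_adj (rev P ! ?i # T)" using T(4) rev[of i] i by (simp add: m_def)
      qed (use max T ne in auto)
      moreover have "rev P ! ?i = P ! i" using rev[of i] i by (simp add: m_def)
      moreover have "length (rev P) - b = (length P + 1) div 2" using ab(5) by (simp add: m_def)
      ultimately show ?thesis by (simp only: T(5))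
    qed
  qed
qed

section \<open>Transport of chips through the tree and the rank estimate\<close>

context param_tree_of_loops
begin

lemma lin_equiv_refl: "D \<in> Divs \<Gamma> \<Longrightarrow> (D, D) \<in> lin_equiv \<Gamma>"
  using principal_0 by (simp add: lin_equiv_def)

lemma lin_equiv_trans:
  assumes "(D, E) \<in> lin_equiv \<Gamma>" "(E, F) \<in> lin_equiv \<Gamma>"
  shows "(D, F) \<in> lin_equiv \<Gamma>"
  using assms principal_add[of "D - E" "E - F"] by (simp add: lin_equiv_def)

lemma lin_equiv_add:
  assumes "(D, E) \<in> lin_equiv \<Gamma>" "F \<in> Divs \<Gamma>"
  shows "(D + F, E + F) \<in> lin_equiv \<Gamma>"
  using assms by (simp add: lin_equiv_def Divs_add)

lemma loop_subset: "L \<in> \<L> \<Longrightarrow> x \<in> L \<Longrightarrow> x \<in> \<Gamma>"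
  using Union_loops by blast

text \<open>Three of the points may be prescribed because equal coordinate sums determine the
  fourth, up to multiples of the length.\<close>

lemma two_chips_on_loop:
  assumes A: "A \<in> \<L>" "v \<in> A" "y \<in> A" "w \<in> A"
  shows "\<exists>x\<in>A. (Poly_Mapping.single v 1 + Poly_Mapping.single y 1,
    Poly_Mapping.single w 1 + Poly_Mapping.single x 1) \<in> lin_equiv \<Gamma>"
proof -
  let ?u = "\<tau> A v + \<tau> A y - \<tau> A w"
  have x: "c A ?u \<in> A" by (rule c_in[OF A(1)])
  have "principal \<Gamma> (Poly_Mapping.single (c A (\<tau> A v)) 1 + Poly_Mapping.single (c A (\<tau> A y)) 1
      - Poly_Mapping.single (c A (\<tau> A w)) 1 - Poly_Mapping.single (c A ?u) 1)"
    by (rule principal_four_points[OF A(1)]) simp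
  then have "principal \<Gamma> ((Poly_Mapping.single v 1 + Poly_Mapping.single y 1)
      - (Poly_Mapping.single w 1 + Poly_Mapping.single (c A ?u) 1))"
    using c_\<tau>[OF A(1,2)] c_\<tau>[OF A(1,3)] c_\<tau>[OF A(1,4)] by (simp add: diff_diff_eq)
  then show ?thesis using x A unfolding lin_equiv_def
    by (intro bexI[of _ "c A ?u"]) (auto intro!: Divs_add Divs_single loop_subset)
qed

text \<open>Each further chip at \<open>v\<close> is paired with the stray chip \<open>x\<close> of
  the previous stage; the pair yields one chip at \<open>w\<close> and a new stray one. So a single
  chip goes astray, however many are moved.\<close>

lemma chips_on_loop:
  assumes A: "A \<in> \<L>" "v \<in> A" "w \<in> A"
  shows "\<exists>x\<in>A. (chips (Suc k) v, chips k w + Poly_Mapping.single x 1) \<in> lin_equiv \<Gamma>"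
proof (induction k)
  case 0
  show ?case using A by (intro bexI[of _ v]) (auto intro!: lin_equiv_refl Divs_single loop_subset)
next
  case (Suc k)
  then obtain x where x: "x \<in> A" "(chips (Suc k) v, chips k w + Poly_Mapping.single x 1) \<in> lin_equiv \<Gamma>"
    by blast
  obtain x' where x': "x' \<in> A" "(Poly_Mapping.single v 1 + Poly_Mapping.single x 1,
      Poly_Mapping.single w 1 + Poly_Mapping.single x' 1) \<in> lin_equiv \<Gamma>"
    using two_chips_on_loop[OF A(1,2) x(1) A(3)] by blast
  have "(chips (Suc k) v + Poly_Mapping.single v 1,
      chips k w + Poly_Mapping.single x 1 + Poly_Mapping.single v 1) \<in> lin_equiv \<Gamma>"
    using A by (intro lin_equiv_add x(2) Divs_single loop_subset[of A])
  also have "chips k w + Poly_Mapping.single x 1 + Poly_Mapping.single v 1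
      = Poly_Mapping.single v 1 + Poly_Mapping.single x 1 + chips k w" by (simp only: ac_simps)
  finally have 1: "(chips (Suc k) v + Poly_Mapping.single v 1,
      Poly_Mapping.single v 1 + Poly_Mapping.single x 1 + chips k w) \<in> lin_equiv \<Gamma>" .
  have "(Poly_Mapping.single v 1 + Poly_Mapping.single x 1 + chips k w,
      Poly_Mapping.single w 1 + Poly_Mapping.single x' 1 + chips k w) \<in> lin_equiv \<Gamma>"
    using A by (intro lin_equiv_add x'(2) Divs_single loop_subset[of A])
  also have "Poly_Mapping.single w 1 + Poly_Mapping.single x' 1 + chips k w
      = chips k w + Poly_Mapping.single w 1 + Poly_Mapping.single x' 1" by (simp only: ac_simps)
  finally have "(chips (Suc k) v + Poly_Mapping.single v 1,
      chips k w + Poly_Mapping.single w 1 + Poly_Mapping.single x' 1) \<in> lin_equiv \<Gamma>"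
    by (rule lin_equiv_trans[OF 1])
  then have "(chips (Suc (Suc k)) v, chips (Suc k) w + Poly_Mapping.single x' 1) \<in> lin_equiv \<Gamma>"
    by (simp only: chips_Suc)
  with x'(1) show ?case by blast
qed

text \<open>Each step of a walk in the tree of loops costs one chip.\<close>

lemma chips_near:
  assumes "near \<L> v k L" "p \<in> L"
  shows "\<exists>E\<in>Divs \<Gamma>. effective E \<and> (chips (k + j) v, chips j p + E) \<in> lin_equiv \<Gamma>"
  using assms
proof (induction arbitrary: p j rule: near.induct)
  case (base L)
  then obtain x where "x \<in> L" "(chips (Suc j) v, chips j p + Poly_Mapping.single x 1) \<in> lin_equiv \<Gamma>"
    using chips_on_loop by blast
  then show ?case using base.hyps(1)
    by (intro bexI[of _ "Poly_Mapping.single x 1"]) (auto intro: effective_single Divs_single loop_subset)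
next
  case (step k L L')
  then obtain w where w: "w \<in> L" "w \<in> L'" by blast
  \<comment> \<open>The induction hypothesis is applied with \<open>Suc j\<close>: the additional
    chip is spent on crossing \<open>L'\<close>.\<close>
  obtain E where E: "E \<in> Divs \<Gamma>" "effective E" "(chips (k + Suc j) v, chips (Suc j) w + E) \<in> lin_equiv \<Gamma>"
    using step.IH[OF w(1)] by blast
  obtain x where x: "x \<in> L'" "(chips (Suc j) w, chips j p + Poly_Mapping.single x 1) \<in> lin_equiv \<Gamma>"
    using chips_on_loop[OF step.hyps(2) w(2) step.prems] by blast
  have sx: "Poly_Mapping.single x 1 \<in> Divs \<Gamma>" using x(1) step.hyps(2) by (intro Divs_single loop_subset)
  have "(chips (k + Suc j) v, chips j p + Poly_Mapping.single x 1 + E) \<in> lin_equiv \<Gamma>"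
    using E(3) lin_equiv_add[OF x(2) E(1)] by (rule lin_equiv_trans)
  then have "(chips (Suc k + j) v, chips j p + (Poly_Mapping.single x 1 + E)) \<in> lin_equiv \<Gamma>"
    by (simp only: add_Suc_right add_Suc add.assoc)
  then show ?case
    using E(1,2) sx Divs_add effective_add effective_single[of 1 x] by (metis zero_le_one)
qed

lemma equiv_effective_degree_nonneg:
  assumes "equiv_effective \<Gamma> D"
  shows "div_degree D \<ge> 0"
proof -
  obtain E where "principal \<Gamma> (D - E)" "effective E"
    using assms unfolding equiv_effective_def lin_equiv_def by auto
  then show ?thesis
    using div_degree_principal[of "D - E"] effective_degree_nonneg[of E] by (simp add: div_degree_diff)
qed

text \<open>An effective divisor of degree 1 is a single point \<open>p\<close>, so what is required
  is an equivalent effective divisor with a chip at \<open>p\<close>; \<open>chips_near\<close> with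
  \<open>j = 1\<close> provides it.\<close>

lemma div_rank_chips:
  assumes v: "v \<in> \<Gamma>" and near: "\<And>L. L \<in> \<L> \<Longrightarrow> near \<L> v k L"
  shows "div_rank \<Gamma> (chips (Suc k) v) \<ge> 1"
proof -
  let ?D = "chips (Suc k) v"
  let ?P = "\<lambda>r. \<forall>E\<in>Divs \<Gamma>. effective E \<and> div_degree E = int r \<longrightarrow> equiv_effective \<Gamma> (?D - E)"
  have D: "?D \<in> Divs \<Gamma>" by (rule Divs_single[OF v])
  then have "equiv_effective \<Gamma> ?D"
    unfolding equiv_effective_def using lin_equiv_refl[OF D] effective_single[of "int (Suc k)" v] by auto
  moreover have "?P 1"
  proof (intro ballI impI)
    fix E assume E: "E \<in> Divs \<Gamma>" "effective E \<and> div_degree E = int 1"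
    then obtain p where p: "E = Poly_Mapping.single p 1" using effective_degree_1 by auto
    then have "p \<in> \<Gamma>" using E(1) by (simp add: Divs_def)
    then obtain L where L: "L \<in> \<L>" "p \<in> L" using Union_loops by blast
    obtain F where F: "F \<in> Divs \<Gamma>" "effective F" "(chips (k + 1) v, chips 1 p + F) \<in> lin_equiv \<Gamma>"
      using chips_near[OF near[OF L(1)] L(2), of 1] by blast
    then have "(?D - E, F) \<in> lin_equiv \<Gamma>"
      using D E(1) unfolding lin_equiv_def by (auto simp: p Divs_diff diff_diff_eq)
    with F(2) show "equiv_effective \<Gamma> (?D - E)" unfolding equiv_effective_def by blast
  qed
  \<comment> \<open>\<open>GREATEST\<close> needs an upper bound to be meaningful. Testing the
    property on \<open>r\<close> chips at \<open>v\<close> itself gives one by degree.\<close>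
  moreover have "r \<le> Suc k" if "?P r" for r
  proof -
    have "equiv_effective \<Gamma> (?D - chips r v)"
      using that Divs_single[OF v] effective_single[of "int r" v] by (simp add: div_degree_single)
    then have "div_degree (?D - chips r v) \<ge> 0" by (rule equiv_effective_degree_nonneg)
    then show ?thesis by (simp add: div_degree_diff div_degree_single)
  qed
  ultimately have "(GREATEST r. ?P r) \<ge> 1" by (intro Greatest_le_nat[of ?P 1 "Suc k"]) blast+
  with \<open>equiv_effective \<Gamma> ?D\<close> show ?thesis unfolding div_rank_def by simp
qed

lemma W_nonempty:
  assumes "D \<in> Divs \<Gamma>" "div_degree D = int d" "div_rank \<Gamma> D \<ge> int r"
  shows "W r d \<Gamma> \<noteq> {}"
proof -
  have "lin_equiv \<Gamma> `` {D} \<in> Pic (int d) \<Gamma>" unfolding Pic_def using assms(1,2) by (intro quotientI) simp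
  moreover have "D \<in> lin_equiv \<Gamma> `` {D}" using lin_equiv_refl[OF assms(1)] by simp
  ultimately show ?thesis unfolding W_def using assms(3) by blast
qed

end

theorem theoremB:
  fixes \<Gamma> :: "'a::metric_space set" and \<L> :: "'a set set"
  assumes "tree_of_loops \<Gamma> \<L>"
    and "\<And>P. path_of_loops \<L> P \<Longrightarrow> int (length P) \<le> genus \<Gamma> - 2"
  shows "\<not> weakly_BN_general \<Gamma>"
proof
  assume BN: "weakly_BN_general \<Gamma>"
  have loops: "\<forall>L\<in>\<L>. is_loop L" using assms(1) unfolding tree_of_loops_def by (elim conjE)
  then have "\<forall>L\<in>\<L>. \<exists>c l. loop_param c l L" using is_loop_param by blast
  then obtain c l where "\<forall>L\<in>\<L>. loop_param (c L) (l L) L" by metis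
  then interpret param_tree_of_loops \<Gamma> \<L> c l using assms(1) by unfold_locales auto
  have ne: "{} \<notin> \<L>" using c_in by blast
  have "\<L> \<noteq> {}" using graph_tree_loops unfolding graph_tree_def by blast
  then obtain P where P: "path_of_loops \<L> P"
    and max: "\<forall>Q. path_of_loops \<L> Q \<longrightarrow> length Q \<le> length P"
    using longest_graph_path[OF finite_loops] by metis
  define k where "k = (length P + 1) div 2"
  obtain v where v: "v \<in> \<Gamma>" "\<And>L. L \<in> \<L> \<Longrightarrow> near \<L> v k L"
    using tree_of_loops_centre[OF graph_tree_loops P max[rule_format] ne] unfolding k_def Union_loops[symmetric] by blast
  have "W 1 (Suc k) \<Gamma> \<noteq> {}"
    using div_rank_chips[OF v]
    by (intro W_nonempty[OF Divs_single[OF v(1)] div_degree_single]) simp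
  moreover have "2 * k \<le> length P + 1" unfolding k_def by simp
  then have "rho (genus \<Gamma>) 1 (Suc k) < 0"
    using assms(2)[OF P] unfolding rho_def by (simp add: algebra_simps)
  ultimately show False using BN unfolding weakly_BN_general_def by (metis not_less)
qed


end
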